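(* Let $G$ be a group and $n\geq 2$ a natural number. Let $P$ be one of the following properties of groups: finite, nilpotent, perfect, solvable. Then $G$ has the property $P$ if and only if $\widetilde{\mathcal K}(G,n)$ has the property $P$.
   Context: For a group $G$ and $n\geq 2$, let $G^{\rm ab}=G/[G,G]$ and let $\mathcal K(G,n)$ be the kernel of the homomorphism $G^n\to G^{\rm ab}$, $(g_1,\dots,g_n)\mapsto\overline{g_1\cdots g_n}$. Choose a presentation $G\cong F/N$ with $F$ a free group and $N$ a normal subgroup of $F$. Let $\langle\langle\mathcal K(N,n)\rangle\rangle$ be the normal closure of $\mathcal K(N,n)$ in $F^n$ (it is contained in $\mathcal K(F,n)$), and define $\widetilde{\mathcal K}(G,n):=\mathcal K(F,n)/\langle\langle\mathcal K(N,n)\rangle\rangle$. Up to isomorphism this does not depend on the choice of presentation. *)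

theory Defs
  imports "HOL-Algebra.Solvable_Groups" "HOL-Algebra.Product_Groups"
begin

definition list_mult :: "('a, 'b) monoid_scheme \<Rightarrow> 'a list \<Rightarrow> 'a" where
  "list_mult G xs = foldr (\<otimes>\<^bsub>G\<^esub>) xs \<one>\<^bsub>G\<^esub>"

text \<open>A word over \<open>S\<close> is a list of letters \<open>(x, \<epsilon>)\<close> with \<open>x \<in> S\<close>, where \<open>(x, True)\<close> stands for \<open>x\<close>
  and \<open>(x, False)\<close> for its formal inverse. It is reduced if no letter is followed by its
  formal inverse.\<close>

definition reduced_words :: "'a set \<Rightarrow> ('a \<times> bool) list set" where
  "reduced_words S =
     {w \<in> lists (S \<times> UNIV). successively (\<lambda>(x, \<epsilon>) (y, \<delta>). \<not> (x = y \<and> \<epsilon> \<noteq> \<delta>)) w}"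

definition word_value :: "('a, 'b) monoid_scheme \<Rightarrow> ('a \<times> bool) list \<Rightarrow> 'a" where
  "word_value F w = list_mult F (map (\<lambda>(x, \<epsilon>). if \<epsilon> then x else inv\<^bsub>F\<^esub> x) w)"

text \<open>\<open>F\<close> is free on \<open>S\<close> if every element of \<open>F\<close> is the value of a unique reduced word over \<open>S\<close>.
  The basis is allowed to be empty or infinite.\<close>

definition free_on :: "('a, 'b) monoid_scheme \<Rightarrow> 'a set \<Rightarrow> bool" where
  "free_on F S \<longleftrightarrow> group F \<and> S \<subseteq> carrier F \<and>
     bij_betw (word_value F) (reduced_words S) (carrier F)"

definition free_group :: "('a, 'b) monoid_scheme \<Rightarrow> bool" where
  "free_group F \<longleftrightarrow> (\<exists>S. free_on F S)"

definition presentation ::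
  "('f, 'c) monoid_scheme \<Rightarrow> 'f set \<Rightarrow> ('a, 'b) monoid_scheme \<Rightarrow> bool" where
  "presentation F N G \<longleftrightarrow> free_group F \<and> N \<lhd> F \<and> F Mod N \<cong> G"

definition abelianization :: "('a, 'b) monoid_scheme \<Rightarrow> 'a set monoid" where
  "abelianization G = G Mod derived G (carrier G)"

definition power_group :: "('a, 'b) monoid_scheme \<Rightarrow> nat \<Rightarrow> (nat \<Rightarrow> 'a) monoid" where
  "power_group G n = product_group {1..n} (\<lambda>_. G)"

definition K_subgroup :: "('a, 'b) monoid_scheme \<Rightarrow> nat \<Rightarrow> (nat \<Rightarrow> 'a) set" where
  "K_subgroup G n = kernel (power_group G n) (abelianization G)
     (\<lambda>g. derived G (carrier G) #>\<^bsub>G\<^esub> list_mult G (map g [1..<Suc n]))"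

definition normal_closure :: "('a, 'b) monoid_scheme \<Rightarrow> 'a set \<Rightarrow> 'a set" where
  "normal_closure G A = \<Inter> {M. M \<lhd> G \<and> A \<subseteq> M}"

text \<open>The quotient \<open>\<K>(F,n) / \<langle>\<langle>\<K>(N,n)\<rangle>\<rangle>\<close>; \<open>\<K>(N,n)\<close> is formed in \<open>N\<close> regarded as a group in its own
  right (so with the commutator subgroup of \<open>N\<close>), while its normal closure is taken in \<open>F\<^sup>n\<close>.\<close>

definition K_tilde :: "('f, 'c) monoid_scheme \<Rightarrow> 'f set \<Rightarrow> nat \<Rightarrow> (nat \<Rightarrow> 'f) set monoid" where
  "K_tilde F N n = ((power_group F n)\<lparr>carrier := K_subgroup F n\<rparr>) Mod
     normal_closure (power_group F n) (K_subgroup (F\<lparr>carrier := N\<rparr>) n)"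

fun lower_central :: "('a, 'b) monoid_scheme \<Rightarrow> nat \<Rightarrow> 'a set" where
  "lower_central G 0 = carrier G"
| "lower_central G (Suc k) = generate G
     {x \<otimes>\<^bsub>G\<^esub> y \<otimes>\<^bsub>G\<^esub> inv\<^bsub>G\<^esub> x \<otimes>\<^bsub>G\<^esub> inv\<^bsub>G\<^esub> y | x y. x \<in> lower_central G k \<and> y \<in> carrier G}"

definition nilpotent :: "('a, 'b) monoid_scheme \<Rightarrow> bool" where
  "nilpotent G \<longleftrightarrow> (\<exists>k. lower_central G k = {\<one>\<^bsub>G\<^esub>})"

definition perfect :: "('a, 'b) monoid_scheme \<Rightarrow> bool" where
  "perfect G \<longleftrightarrow> derived G (carrier G) = carrier G"

end

theory Submission
  imports Defs "HOL-Algebra.Multiplicative_Group"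
begin

text \<open>
  Write \<open>G = F/N\<close> and let \<open>R = [F,N]\<close>, so that \<open>E = F/R\<close> is a central extension of \<open>G\<close> by \<open>N/R\<close>.
  Everything rests on one computation: the normal closure \<open>L\<close> of \<open>\<K>(N,n)\<close> in \<open>F\<^sup>n\<close> consists of
  the tuples in \<open>N\<^sup>n\<close> whose product lies in \<open>R\<close> (lemma \<open>L_eq_balanced\<close>). Indeed,
  \<open>(x, x\<inverse>, 1, \<dots>, 1)\<close> lies in \<open>\<K>(N,n)\<close> for \<open>x \<in> N\<close>, and its commutators with \<open>(y, 1, \<dots>, 1)\<close>
  are \<open>([x,y], 1, \<dots>, 1)\<close>, so that \<open>L\<close> contains \<open>R\<close> in the first coordinate; conversely, \<open>N\<close>
  becomes central modulo \<open>R\<close>, so that the product of a tuple in \<open>N\<^sup>n\<close> taken modulo \<open>R\<close> is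
  multiplicative and invariant under conjugation. Hence the class modulo \<open>L\<close> of a tuple is
  determined by its coordinates modulo \<open>N\<close> and its product modulo \<open>R\<close>
  (lemma \<open>q_eq_if_same_invariants\<close>).

  The quotient \<open>\<K>(F,n)/L\<close> maps onto \<open>G\<close> by the first coordinate, because \<open>n \<ge> 2\<close> leaves a second
  coordinate free to correct the product; this transports all four properties to \<open>G\<close>. In the
  other direction:

  \<^item> The coordinate maps to \<open>G\<close> have a central common kernel, so nilpotency and solvability of \<open>G\<close>
    are inherited, at the cost of one more step in the series.

  \<^item> If \<open>G\<close> is finite, then so is \<open>[E,E]\<close>, by Schur's theorem
    (\<open>finite_derived_if_central_kernel\<close>). The two invariants above then take finitely many values
    on \<open>\<K>(F,n)\<close>: the coordinates in \<open>G\<close>, and the product in \<open>[E,E]\<close>.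

  \<^item> If \<open>G\<close> is perfect, then \<open>F = F''N\<close>, and \<open>[E,E]\<close> is perfect, since a commutator in \<open>E\<close> depends
    only on the images in \<open>G\<close>. The coordinates of an element of \<open>\<K>(F,n)\<close> can therefore be moved
    into \<open>F''\<close> without changing either invariant, that is, without changing the class modulo \<open>L\<close>.
    Now \<open>(F'')\<^sup>n\<close> lies in the commutator subgroup of \<open>\<K>(F,n)\<close>, because \<open>(F')\<^sup>n \<subseteq> \<K>(F,n)\<close>.
\<close>

section \<open>Products along a list\<close>

lemma list_mult_Nil [simp]: "list_mult G [] = \<one>\<^bsub>G\<^esub>"
  and list_mult_Cons [simp]: "list_mult G (x # xs) = x \<otimes>\<^bsub>G\<^esub> list_mult G xs"
  by (simp_all add: list_mult_def)

lemma (in monoid) list_mult_closed: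
  "set xs \<subseteq> carrier G \<Longrightarrow> list_mult G xs \<in> carrier G"
  by (induction xs) auto

lemma (in group_hom) hom_list_mult:
  "set xs \<subseteq> carrier G \<Longrightarrow> h (list_mult G xs) = list_mult H (map h xs)"
  by (induction xs) (auto simp: G.list_mult_closed)

lemma (in group) list_mult_mult_central:
  assumes "\<And>i. i \<in> set is \<Longrightarrow> f i \<in> carrier G" "\<And>i. i \<in> set is \<Longrightarrow> g i \<in> carrier G"
    and "\<And>i x. i \<in> set is \<Longrightarrow> x \<in> carrier G \<Longrightarrow> g i \<otimes> x = x \<otimes> g i"
  shows "list_mult G (map (\<lambda>i. f i \<otimes> g i) is) = list_mult G (map f is) \<otimes> list_mult G (map g is)"
  using assms
proof (induction "is")
  case (Cons i "is")
  have cl: "list_mult G (map f is) \<in> carrier G" "list_mult G (map g is) \<in> carrier G"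
      "f i \<in> carrier G" "g i \<in> carrier G"
    using Cons.prems by (auto intro!: list_mult_closed)
  have "g i \<otimes> list_mult G (map f is) = list_mult G (map f is) \<otimes> g i"
    using Cons.prems(3) cl by simp
  then have "g i \<otimes> (list_mult G (map f is) \<otimes> list_mult G (map g is))
      = list_mult G (map f is) \<otimes> (g i \<otimes> list_mult G (map g is))"
    using cl by (simp flip: m_assoc)
  then show ?case
    using Cons cl by (simp add: m_assoc)
qed simp

lemma (in monoid) list_mult_single:
  assumes "distinct is" "x \<in> carrier G"
  shows "list_mult G (map (\<lambda>j. if j = i then x else \<one>) is) = (if i \<in> set is then x else \<one>)"
  using assms by (induction "is") auto

lemma (in group) mult_inv_cancel:
  assumes "x \<in> carrier G" "y \<in> carrier G"
  shows "x \<otimes> (inv x \<otimes> y) = y" "inv x \<otimes> (x \<otimes> y) = y"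
  using assms by (simp_all flip: m_assoc)

section \<open>Commutator subgroups and homomorphisms\<close>

text \<open>For subgroups \<open>X\<close> and \<open>Y\<close> this is \<open>[X,Y]\<close>. It gives the steps of the lower central series
  and of the derived series a common form.\<close>

definition rel_commutator :: "('a, 'b) monoid_scheme \<Rightarrow> 'a set \<Rightarrow> 'a set \<Rightarrow> 'a set" where
  "rel_commutator G X Y = generate G
     {x \<otimes>\<^bsub>G\<^esub> y \<otimes>\<^bsub>G\<^esub> inv\<^bsub>G\<^esub> x \<otimes>\<^bsub>G\<^esub> inv\<^bsub>G\<^esub> y | x y. x \<in> X \<and> y \<in> Y}"

lemma lower_central_Suc: "lower_central G (Suc k) = rel_commutator G (lower_central G k) (carrier G)"
  by (simp add: rel_commutator_def)

lemma derived_eq_rel_commutator: "derived G X = rel_commutator G X X"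
  unfolding derived_def rel_commutator_def by (rule arg_cong[of _ _ "generate G"]) auto

context group
begin

lemma commutators_in_carrier:
  assumes "X \<subseteq> carrier G" "Y \<subseteq> carrier G"
  shows "{x \<otimes> y \<otimes> inv x \<otimes> inv y | x y. x \<in> X \<and> y \<in> Y} \<subseteq> carrier G"
  using assms by blast

lemma rel_commutator_subgroup:
  assumes "X \<subseteq> carrier G" "Y \<subseteq> carrier G"
  shows "subgroup (rel_commutator G X Y) G"
  unfolding rel_commutator_def using generate_is_subgroup[OF commutators_in_carrier[OF assms]] .

lemma rel_commutator_incl:
  assumes "x \<in> X" "y \<in> Y"
  shows "x \<otimes> y \<otimes> inv x \<otimes> inv y \<in> rel_commutator G X Y"
  unfolding rel_commutator_def using assms by (blast intro: generate.incl)

lemma rel_commutator_mono: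
  assumes "X \<subseteq> X'" "Y \<subseteq> Y'"
  shows "rel_commutator G X Y \<subseteq> rel_commutator G X' Y'"
  unfolding rel_commutator_def by (rule mono_generate) (use assms in blast)

lemma rel_commutator_least:
  assumes "subgroup M G" "\<And>x y. x \<in> X \<Longrightarrow> y \<in> Y \<Longrightarrow> x \<otimes> y \<otimes> inv x \<otimes> inv y \<in> M"
  shows "rel_commutator G X Y \<subseteq> M"
  unfolding rel_commutator_def by (rule generate_subgroup_incl[OF _ assms(1)]) (use assms(2) in blast)

lemma commutator_eq_one_iff:
  assumes "x \<in> carrier G" "y \<in> carrier G"
  shows "x \<otimes> y \<otimes> inv x \<otimes> inv y = \<one> \<longleftrightarrow> x \<otimes> y = y \<otimes> x"
proof -
  have "x \<otimes> y \<otimes> inv x \<otimes> inv y = \<one> \<longleftrightarrow> x \<otimes> y \<otimes> inv x = y"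
    using assms by (metis inv_closed inv_solve_right l_one m_closed one_closed)
  also have "\<dots> \<longleftrightarrow> x \<otimes> y = y \<otimes> x"
    using assms by (metis inv_closed inv_solve_right m_closed)
  finally show ?thesis .
qed

lemma rel_commutator_trivial:
  assumes "X \<subseteq> carrier G" "Y \<subseteq> carrier G" "\<And>x y. x \<in> X \<Longrightarrow> y \<in> Y \<Longrightarrow> x \<otimes> y = y \<otimes> x"
  shows "rel_commutator G X Y = {\<one>}"
proof
  show "rel_commutator G X Y \<subseteq> {\<one>}"
    by (rule rel_commutator_least[OF triv_subgroup])
      (use assms in \<open>simp add: commutator_eq_one_iff subset_iff\<close>)
  show "{\<one>} \<subseteq> rel_commutator G X Y"
    using subgroup.one_closed[OF rel_commutator_subgroup[OF assms(1,2)]] by simp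
qed

lemma lower_central_subgroup: "subgroup (lower_central G k) G"
proof (induction k)
  case (Suc k)
  show ?case
    unfolding lower_central_Suc
    by (rule rel_commutator_subgroup) (use Suc subgroup.subset in auto)
qed (simp add: subgroup_self)

lemma rel_commutator_normal:
  assumes "X \<lhd> G" "Y \<lhd> G"
  shows "rel_commutator G X Y \<lhd> G"
  unfolding rel_commutator_def
proof (rule normal_generateI)
  have sub: "X \<subseteq> carrier G" "Y \<subseteq> carrier G"
    using assms normal_imp_subgroup subgroup.subset by blast+
  show "{x \<otimes> y \<otimes> inv x \<otimes> inv y | x y. x \<in> X \<and> y \<in> Y} \<subseteq> carrier G"
    by (rule commutators_in_carrier[OF sub])
  fix c g
  assume "c \<in> {x \<otimes> y \<otimes> inv x \<otimes> inv y | x y. x \<in> X \<and> y \<in> Y}" and g: "g \<in> carrier G"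
  then obtain x y where xy: "x \<in> X" "y \<in> Y" "c = x \<otimes> y \<otimes> inv x \<otimes> inv y"
    by blast
  have cl: "x \<in> carrier G" "y \<in> carrier G"
    using xy sub by auto
  let ?x = "g \<otimes> x \<otimes> inv g" and ?y = "g \<otimes> y \<otimes> inv g"
  have "g \<otimes> c \<otimes> inv g = ?x \<otimes> ?y \<otimes> inv ?x \<otimes> inv ?y"
    using g cl by (simp add: xy(3) inv_mult_group m_assoc mult_inv_cancel)
  moreover have "?x \<in> X" "?y \<in> Y"
    using assms g xy(1,2) by (simp_all add: normal_invE(2))
  ultimately show "g \<otimes> c \<otimes> inv g \<in> {x \<otimes> y \<otimes> inv x \<otimes> inv y | x y. x \<in> X \<and> y \<in> Y}"
    by blast
qed

end

context group_hom
begin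

lemma rel_commutator_img:
  assumes "X \<subseteq> carrier G" "Y \<subseteq> carrier G"
  shows "rel_commutator H (h ` X) (h ` Y) = h ` rel_commutator G X Y"
proof -
  have "{x \<otimes>\<^bsub>H\<^esub> y \<otimes>\<^bsub>H\<^esub> inv\<^bsub>H\<^esub> x \<otimes>\<^bsub>H\<^esub> inv\<^bsub>H\<^esub> y | x y. x \<in> h ` X \<and> y \<in> h ` Y}
      = h ` {x \<otimes> y \<otimes> inv x \<otimes> inv y | x y. x \<in> X \<and> y \<in> Y}" (is "?L = h ` ?R")
  proof -
    have *: "h (x \<otimes> y \<otimes> inv x \<otimes> inv y) = h x \<otimes>\<^bsub>H\<^esub> h y \<otimes>\<^bsub>H\<^esub> inv\<^bsub>H\<^esub> h x \<otimes>\<^bsub>H\<^esub> inv\<^bsub>H\<^esub> h y"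
      if "x \<in> X" "y \<in> Y" for x y
      using that assms by (simp add: subset_iff)
    show ?thesis
    proof (intro subset_antisym subsetI)
      fix c
      assume "c \<in> ?L"
      then obtain x y where "x \<in> X" "y \<in> Y"
          "c = h x \<otimes>\<^bsub>H\<^esub> h y \<otimes>\<^bsub>H\<^esub> inv\<^bsub>H\<^esub> h x \<otimes>\<^bsub>H\<^esub> inv\<^bsub>H\<^esub> h y"
        by blast
      then show "c \<in> h ` ?R"
        by (intro image_eqI[of _ _ "x \<otimes> y \<otimes> inv x \<otimes> inv y"]) (simp only: *, blast)
    next
      fix c
      assume "c \<in> h ` ?R"
      then obtain x y where "x \<in> X" "y \<in> Y" "c = h (x \<otimes> y \<otimes> inv x \<otimes> inv y)"
        by blast
      then show "c \<in> ?L"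
        using * by (intro CollectI exI[of _ "h x"] exI[of _ "h y"]) simp
    qed
  qed
  then show ?thesis
    unfolding rel_commutator_def using generate_img[OF G.commutators_in_carrier[OF assms]] by simp
qed

lemma lower_central_img: "h ` lower_central G k \<subseteq> lower_central H k"
proof (induction k)
  case (Suc k)
  have "h ` lower_central G (Suc k) = rel_commutator H (h ` lower_central G k) (h ` carrier G)"
    unfolding lower_central_Suc
    by (rule rel_commutator_img[symmetric]) (simp_all add: subgroup.subset[OF G.lower_central_subgroup])
  also have "\<dots> \<subseteq> lower_central H (Suc k)"
    unfolding lower_central_Suc by (rule H.rel_commutator_mono[OF Suc.IH]) auto
  finally show ?case .
qed auto

lemma lower_central_surj_img:
  assumes "h ` carrier G = carrier H"
  shows "h ` lower_central G k = lower_central H k"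
proof (induction k)
  case (Suc k)
  show ?case
    using rel_commutator_img[OF subgroup.subset[OF G.lower_central_subgroup] subset_refl, of k]
    unfolding lower_central_Suc Suc.IH assms by (rule sym)
qed (simp add: assms)

lemma surj_hom_imp_nilpotent:
  assumes "h ` carrier G = carrier H" "nilpotent G"
  shows "nilpotent H"
proof -
  obtain k where "lower_central G k = {\<one>}"
    using assms(2) unfolding nilpotent_def by blast
  then have "lower_central H k = {\<one>\<^bsub>H\<^esub>}"
    using lower_central_surj_img[OF assms(1), of k] by simp
  then show ?thesis
    unfolding nilpotent_def by blast
qed

lemma surj_hom_imp_perfect:
  assumes "h ` carrier G = carrier H" "perfect G"
  shows "perfect H"
proof -
  have "derived H (h ` carrier G) = h ` derived G (carrier G)"
    by (rule derived_img[OF subset_refl])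
  then show ?thesis
    using assms(2) unfolding perfect_def assms(1) by (metis assms(1))
qed

end

lemma (in normal) kernel_r_coset: "kernel G (G Mod H) (\<lambda>x. H #> x) = H"
proof -
  have "H #> x = H \<longleftrightarrow> x \<in> H" if "x \<in> carrier G" for x
    using coset_join1[OF _ that subgroup_axioms] coset_join2[OF that subgroup_axioms] by blast
  then show ?thesis
    unfolding kernel_def one_FactGroup using subset by auto
qed

text \<open>Homomorphisms carry the lower central and derived series of \<open>A\<close> into those of \<open>B\<close>. So once the
  series of \<open>B\<close> has become trivial, that of \<open>A\<close> has entered the common kernel, where all
  commutators with elements of \<open>A\<close> vanish. A family of homomorphisms, instead of a single one into
  a power of \<open>B\<close>, avoids having to pass to subgroups of powers.\<close>

lemma
  assumes "group A" "group B"
    and hom: "\<And>i. i \<in> I \<Longrightarrow> \<sigma> i \<in> hom A B"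
    and central: "\<And>x y. \<lbrakk>x \<in> carrier A; \<And>i. i \<in> I \<Longrightarrow> \<sigma> i x = \<one>\<^bsub>B\<^esub>; y \<in> carrier A\<rbrakk>
      \<Longrightarrow> x \<otimes>\<^bsub>A\<^esub> y = y \<otimes>\<^bsub>A\<^esub> x"
  shows nilpotent_if_jointly_central_kernel: "nilpotent B \<Longrightarrow> nilpotent A"
    and solvable_if_jointly_central_kernel: "solvable B \<Longrightarrow> solvable A"
proof -
  interpret A: group A by fact
  interpret B: group B by fact
  have gh: "group_hom A B (\<sigma> i)" if "i \<in> I" for i
    using that hom by unfold_locales
  have trivial: "rel_commutator A X Y = {\<one>\<^bsub>A\<^esub>}"
    if "X \<subseteq> carrier A" "Y \<subseteq> carrier A" "\<And>i. i \<in> I \<Longrightarrow> \<sigma> i ` X \<subseteq> {\<one>\<^bsub>B\<^esub>}" for X Y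
  proof (rule A.rel_commutator_trivial[OF that(1,2)])
    fix x y
    assume "x \<in> X" "y \<in> Y"
    then show "x \<otimes>\<^bsub>A\<^esub> y = y \<otimes>\<^bsub>A\<^esub> x"
      using that by (intro central) (blast+)
  qed
  show "nilpotent A" if "nilpotent B"
  proof -
    from that obtain k where k: "lower_central B k = {\<one>\<^bsub>B\<^esub>}"
      unfolding nilpotent_def by blast
    have "\<sigma> i ` lower_central A k \<subseteq> {\<one>\<^bsub>B\<^esub>}" if "i \<in> I" for i
      using group_hom.lower_central_img[OF gh[OF that], of k] unfolding k .
    then have "lower_central A (Suc k) = {\<one>\<^bsub>A\<^esub>}"
      unfolding lower_central_Suc
      by (intro trivial subgroup.subset[OF A.lower_central_subgroup] subset_refl)
    then show "nilpotent A"
      unfolding nilpotent_def by (rule exI)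
  qed
  show "solvable A" if "solvable B"
  proof -
    from that obtain k where k: "(derived B ^^ k) (carrier B) = {\<one>\<^bsub>B\<^esub>}"
      using B.solvable_iff_trivial_derived_seq by blast
    let ?D = "(derived A ^^ k) (carrier A)"
    have "\<sigma> i ` ?D \<subseteq> {\<one>\<^bsub>B\<^esub>}" if "i \<in> I" for i
    proof -
      interpret group_hom A B "\<sigma> i"
        by (rule gh[OF that])
      have "\<sigma> i ` carrier A \<subseteq> carrier B"
        by (rule image_subsetI) (rule hom_closed)
      from B.mono_exp_of_derived[OF this, of k] show ?thesis
        unfolding k exp_of_derived_img[OF subset_refl] .
    qed
    then have "derived A ?D = {\<one>\<^bsub>A\<^esub>}"
      unfolding derived_eq_rel_commutator[of A ?D]
      by (intro trivial A.exp_of_derived_in_carrier subset_refl)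
    then have "(derived A ^^ Suc k) (carrier A) = {\<one>\<^bsub>A\<^esub>}"
      by simp
    then show "solvable A"
      using A.solvable_iff_trivial_derived_seq by blast
  qed
qed

section \<open>Schur's theorem on central extensions of finite groups\<close>

context group
begin

lemma list_mult_append:
  "set xs \<subseteq> carrier G \<Longrightarrow> set ys \<subseteq> carrier G \<Longrightarrow>
    list_mult G (xs @ ys) = list_mult G xs \<otimes> list_mult G ys"
  by (induction xs) (auto simp: list_mult_closed m_assoc)

lemma list_mult_replicate:
  "x \<in> carrier G \<Longrightarrow> list_mult G (replicate k x) = x [^] k"
  by (induction k) (simp_all add: nat_pow_Suc2 del: nat_pow_Suc Group.nat_pow_Suc)

text \<open>Moving an occurrence of \<open>c\<close> to the front conjugates the letters that it passes, which stay in \<open>C\<close>.\<close>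

lemma collect_power_to_front:
  assumes "set ws \<subseteq> C" "C \<subseteq> carrier G" "c \<in> carrier G"
    and conj: "\<And>x g. x \<in> C \<Longrightarrow> g \<in> carrier G \<Longrightarrow> g \<otimes> x \<otimes> inv g \<in> C"
    and "j \<le> count_list ws c"
  shows "\<exists>vs. set vs \<subseteq> C \<and> length vs = length ws - j
    \<and> list_mult G ws = c [^] j \<otimes> list_mult G vs"
  using assms(1,5)
proof (induction ws arbitrary: j)
  case Nil
  then show ?case
    by (intro exI[of _ "[]"]) simp
next
  case (Cons w ws)
  have w: "w \<in> C" "w \<in> carrier G" and ws: "set ws \<subseteq> C"
    using Cons.prems(1) assms(2) by auto
  show ?case
  proof (cases "w = c \<and> j > 0")
    case True
    then obtain i where i: "j = Suc i" "i \<le> count_list ws c"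
      using Cons.prems(2) by (cases j) auto
    obtain vs where vs: "set vs \<subseteq> C" "length vs = length ws - i"
        "list_mult G ws = c [^] i \<otimes> list_mult G vs"
      using Cons.IH[OF ws i(2)] by blast
    have "list_mult G vs \<in> carrier G"
      using vs(1) assms(2) by (auto intro: list_mult_closed)
    moreover have "c [^] j = c \<otimes> c [^] i"
      unfolding i(1) by (rule nat_pow_Suc2[OF assms(3)])
    ultimately have "list_mult G (w # ws) = c [^] j \<otimes> list_mult G vs"
      using True assms(3) by (simp add: vs(3) m_assoc)
    then show ?thesis
      using vs(1,2) i(1) by (intro exI[of _ vs]) simp
  next
    case False
    then have j: "j \<le> count_list ws c"
      using Cons.prems(2) by (auto split: if_splits)
    obtain vs where vs: "set vs \<subseteq> C" "length vs = length ws - j"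
        "list_mult G ws = c [^] j \<otimes> list_mult G vs"
      using Cons.IH[OF ws j] by blast
    let ?p = "c [^] j"
    let ?w = "inv ?p \<otimes> w \<otimes> inv (inv ?p)"
    have cl: "?p \<in> carrier G" "list_mult G vs \<in> carrier G"
      using assms(2,3) vs(1) by (auto intro: list_mult_closed)
    have "?w \<in> C"
      by (rule conj) (use w cl in auto)
    moreover have "list_mult G (w # ws) = ?p \<otimes> list_mult G (?w # vs)"
      using cl w by (simp add: vs(3) m_assoc mult_inv_cancel)
    moreover have "length (?w # vs) = length (w # ws) - j"
      using vs(2) j count_le_length[of ws c] by simp
    ultimately show ?thesis
      using vs(1) by (intro exI[of _ "?w # vs"]) simp
  qed
qed

lemma mem_generate_list_mult:
  assumes "C \<subseteq> carrier G" "\<And>c. c \<in> C \<Longrightarrow> inv c \<in> C" "x \<in> generate G C"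
  shows "\<exists>ws. set ws \<subseteq> C \<and> x = list_mult G ws"
  using assms(3)
proof induction
  case one
  then show ?case
    by (intro exI[of _ "[]"]) simp
next
  case (incl c)
  then show ?case
    using assms(1) by (intro exI[of _ "[c]"]) auto
next
  case (inv c)
  then show ?case
    using assms(1) assms(2)[OF inv] by (intro exI[of _ "[inv c]"]) auto
next
  case (eng x y)
  then obtain us vs where "set us \<subseteq> C" "x = list_mult G us" "set vs \<subseteq> C" "y = list_mult G vs"
    by blast
  then show ?case
    using assms(1) by (intro exI[of _ "us @ vs"]) (auto simp: list_mult_append)
qed

text \<open>A word with more than \<open>card C * m\<close> letters contains some \<open>c\<close> at least \<open>m + 1\<close> times. Collecting
  these occurrences at the front and rewriting \<open>c\<close> to the power \<open>m + 1\<close> with \<open>m\<close> letters makes the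
  word shorter. Hence words of bounded length over the finite alphabet \<open>C\<close> suffice.\<close>

lemma finite_generate_if_powers_shorten:
  assumes fin: "finite C" and C: "C \<subseteq> carrier G"
    and inv: "\<And>c. c \<in> C \<Longrightarrow> inv c \<in> C"
    and conj: "\<And>x g. x \<in> C \<Longrightarrow> g \<in> carrier G \<Longrightarrow> g \<otimes> x \<otimes> inv g \<in> C"
    and shorten: "\<And>c. c \<in> C \<Longrightarrow> \<exists>vs. set vs \<subseteq> C \<and> length vs = m \<and> c [^] Suc m = list_mult G vs"
  shows "finite (generate G C)"
proof -
  have short: "\<exists>vs. set vs \<subseteq> C \<and> length vs \<le> card C * m \<and> list_mult G ws = list_mult G vs"
    if "set ws \<subseteq> C" for ws
    using that
  proof (induction "length ws" arbitrary: ws rule: less_induct)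
    case less
    show ?case
    proof (cases "\<exists>c\<in>C. m < count_list ws c")
      case False
      have "length ws = (\<Sum>c\<in>C. count_list ws c)"
        using sum_count_set[OF less.prems fin] by simp
      also have "\<dots> \<le> (\<Sum>c\<in>C. m)"
        using False by (intro sum_mono) (simp add: not_less)
      finally show ?thesis
        using less.prems by auto
    next
      case True
      then obtain c where c: "c \<in> C" "Suc m \<le> count_list ws c"
        by auto
      have "c \<in> carrier G"
        using c(1) C by blast
      then obtain vs where vs: "set vs \<subseteq> C" "length vs = length ws - Suc m"
          "list_mult G ws = c [^] Suc m \<otimes> list_mult G vs"
        using collect_power_to_front[OF less.prems C _ conj c(2)] by blast
      obtain us where us: "set us \<subseteq> C" "length us = m" "c [^] Suc m = list_mult G us"
        using shorten[OF c(1)] by blast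
      have "list_mult G ws = list_mult G (us @ vs)"
        using us vs C by (simp add: list_mult_append del: nat_pow_Suc)
      moreover have "length (us @ vs) < length ws"
        using us(2) vs(2) c(2) count_le_length[of ws c] by simp
      ultimately show ?thesis
        using less.hyps[of "us @ vs"] us(1) vs(1) by auto
    qed
  qed
  have "generate G C \<subseteq> list_mult G ` {vs. set vs \<subseteq> C \<and> length vs \<le> card C * m}"
  proof
    fix x
    assume "x \<in> generate G C"
    then obtain ws where "set ws \<subseteq> C" "x = list_mult G ws"
      using mem_generate_list_mult[OF C inv] by blast
    then show "x \<in> list_mult G ` {vs. set vs \<subseteq> C \<and> length vs \<le> card C * m}"
      using short[of ws] by auto
  qed
  then show ?thesis
    by (rule finite_subset) (intro finite_imageI finite_lists_length_le fin)
qed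

text \<open>If \<open>c = [x,y]\<close> and \<open>c\<^sup>m\<close> commutes with \<open>x\<close>, then \<open>c\<^sup>m = (x c x\<inverse>)\<^sup>m\<close>, and the last factor of this
  power merges with the remaining \<open>c\<close>, because \<open>(x c x\<inverse>) c = [x\<^sup>2,y]\<close>. So \<open>c\<close> to the power \<open>m + 1\<close> is a product of
  only \<open>m\<close> commutators.\<close>

lemma commutator_power_shorten:
  fixes m :: nat
  assumes "x \<in> carrier G" "y \<in> carrier G"
  defines "c \<equiv> x \<otimes> y \<otimes> inv x \<otimes> inv y"
  assumes "m > 0" and central: "c [^] m \<otimes> x = x \<otimes> c [^] m"
  shows "c [^] Suc m = list_mult G (replicate (m - 1) (x \<otimes> c \<otimes> inv x)
    @ [(x \<otimes> x) \<otimes> y \<otimes> inv (x \<otimes> x) \<otimes> inv y])"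
proof -
  have c: "c \<in> carrier G"
    using assms(1,2) by (simp add: c_def)
  let ?d = "x \<otimes> c \<otimes> inv x"
  have d: "?d \<in> carrier G"
    using c assms(1) by simp
  have pow: "?d [^] k = x \<otimes> c [^] k \<otimes> inv x" for k :: nat
    using c assms(1) by (induction k) (simp_all add: m_assoc mult_inv_cancel)
  have "?d [^] m = c [^] m \<otimes> x \<otimes> inv x"
    unfolding pow central ..
  then have "c [^] m = ?d [^] m"
    using c assms(1) by (simp add: m_assoc)
  also have "\<dots> = ?d [^] (m - 1) \<otimes> ?d"
    using \<open>m > 0\<close> by (cases m) simp_all
  finally have "c [^] Suc m = ?d [^] (m - 1) \<otimes> (?d \<otimes> c)"
    using c d by (simp add: m_assoc)
  also have "?d \<otimes> c = (x \<otimes> x) \<otimes> y \<otimes> inv (x \<otimes> x) \<otimes> inv y"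
    using assms(1,2) by (simp add: c_def m_assoc mult_inv_cancel inv_mult_group)
  finally show ?thesis
    using d assms(1,2) by (simp add: list_mult_append list_mult_replicate set_replicate_conv_if)
qed

end

text \<open>The map \<open>q\<close> factors through \<open>t\<close> on \<open>A\<close>; this is how finitely many values of an invariant bound the
  number of commutators, and later the number of cosets.\<close>

lemma finite_image_if_factors:
  assumes "finite (t ` A)" "\<And>x y. x \<in> A \<Longrightarrow> y \<in> A \<Longrightarrow> t x = t y \<Longrightarrow> q x = q y"
  shows "finite (q ` A)"
proof -
  obtain g where "\<And>x. x \<in> A \<Longrightarrow> q x = g (t x)"
    using assms(2) function_factors_left_gen[of "\<lambda>x. x \<in> A" t q] by blast
  then have "q ` A = g ` (t ` A)"
    by (simp add: image_image)
  then show ?thesis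
    using assms(1) by simp
qed

text \<open>Changing an argument of a commutator by a central factor does not change the commutator. Changing
  one argument at a time, and using \<open>[x,y]\<inverse> = [y,x]\<close>, reduces the claim to the left argument.\<close>

lemma (in group_hom) commutator_cong_if_central_kernel:
  assumes central: "\<And>z x. z \<in> kernel G H h \<Longrightarrow> x \<in> carrier G \<Longrightarrow> z \<otimes> x = x \<otimes> z"
    and "x \<in> carrier G" "x' \<in> carrier G" "y \<in> carrier G" "y' \<in> carrier G"
    and "h x = h x'" "h y = h y'"
  shows "x \<otimes> y \<otimes> inv x \<otimes> inv y = x' \<otimes> y' \<otimes> inv x' \<otimes> inv y'"
proof -
  have left: "x \<otimes> y \<otimes> inv x \<otimes> inv y = x' \<otimes> y \<otimes> inv x' \<otimes> inv y"
    if "x \<in> carrier G" "x' \<in> carrier G" "y \<in> carrier G" "h x = h x'" for x x' y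
  proof -
    let ?z = "inv x' \<otimes> x"
    have z: "?z \<in> kernel G H h" "?z \<in> carrier G"
      using that by (simp_all add: kernel_def)
    have x: "x = x' \<otimes> ?z"
      using that by (simp add: G.mult_inv_cancel)
    have "x \<otimes> y \<otimes> inv x \<otimes> inv y = x' \<otimes> (?z \<otimes> y) \<otimes> inv x \<otimes> inv y"
      using that by (simp add: G.m_assoc G.mult_inv_cancel)
    also have "\<dots> = x' \<otimes> (y \<otimes> ?z) \<otimes> inv x \<otimes> inv y"
      using central[OF z(1)] that by simp
    also have "\<dots> = x' \<otimes> y \<otimes> inv x' \<otimes> inv y"
      using that by (simp add: G.m_assoc G.mult_inv_cancel)
    finally show ?thesis .
  qed
  have inv: "inv (x \<otimes> y \<otimes> inv x \<otimes> inv y) = y \<otimes> x \<otimes> inv y \<otimes> inv x"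
    if "x \<in> carrier G" "y \<in> carrier G" for x y
    using that by (simp add: G.inv_mult_group G.m_assoc)
  have "x \<otimes> y \<otimes> inv x \<otimes> inv y = x' \<otimes> y \<otimes> inv x' \<otimes> inv y"
    using assms by (intro left)
  also have "\<dots> = inv (y \<otimes> x' \<otimes> inv y \<otimes> inv x')"
    using assms by (simp add: inv)
  also have "y \<otimes> x' \<otimes> inv y \<otimes> inv x' = y' \<otimes> x' \<otimes> inv y' \<otimes> inv x'"
    using assms by (intro left)
  also have "inv (y' \<otimes> x' \<otimes> inv y' \<otimes> inv x') = x' \<otimes> y' \<otimes> inv x' \<otimes> inv y'"
    using assms by (simp add: inv)
  finally show ?thesis .
qed

text \<open>Schur's theorem. There are finitely many commutators, since each is determined by the images of
  its arguments. With \<open>m\<close> the order of the image, the power \<open>c\<^sup>m\<close> of a commutator lies in the kernel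
  and is central, so powers of commutators can be shortened.\<close>

theorem (in group_hom) finite_derived_if_central_kernel:
  assumes fin: "finite (h ` carrier G)"
    and central: "\<And>z x. z \<in> kernel G H h \<Longrightarrow> x \<in> carrier G \<Longrightarrow> z \<otimes> x = x \<otimes> z"
  shows "finite (derived G (carrier G))"
proof -
  define com where "com x y = x \<otimes> y \<otimes> inv x \<otimes> inv y" for x y
  define C where "C = {com x y | x y. x \<in> carrier G \<and> y \<in> carrier G}"
  define m where "m = card (h ` carrier G)"
  have m: "m > 0"
    unfolding m_def using fin by (simp add: card_gt_0_iff) (use G.one_closed in blast)
  have com_closed: "com x y \<in> carrier G" if "x \<in> carrier G" "y \<in> carrier G" for x y
    using that by (simp add: com_def)
  have C: "C \<subseteq> carrier G"
    unfolding C_def using com_closed by blast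
  have com_inv: "inv (com x y) = com y x" if "x \<in> carrier G" "y \<in> carrier G" for x y
    using that by (simp add: com_def G.inv_mult_group G.m_assoc)
  have C_image: "C = (\<lambda>(x, y). com x y) ` (carrier G \<times> carrier G)"
    unfolding C_def by auto
  have finC: "finite C"
    unfolding C_image
  proof (rule finite_image_if_factors[where t = "\<lambda>(x, y). (h x, h y)"])
    show "finite ((\<lambda>(x, y). (h x, h y)) ` (carrier G \<times> carrier G))"
      by (rule finite_subset[of _ "h ` carrier G \<times> h ` carrier G"]) (use fin in auto)
    fix u v
    assume "u \<in> carrier G \<times> carrier G" "v \<in> carrier G \<times> carrier G"
      and "(\<lambda>(x, y). (h x, h y)) u = (\<lambda>(x, y). (h x, h y)) v"
    then show "(\<lambda>(x, y). com x y) u = (\<lambda>(x, y). com x y) v"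
      unfolding com_def by (auto intro!: commutator_cong_if_central_kernel[OF central])
  qed
  have com_mem: "com x y \<in> C" if "x \<in> carrier G" "y \<in> carrier G" for x y
    unfolding C_def mem_Collect_eq by (intro exI[of _ x] exI[of _ y] conjI refl that)
  have inv: "inv c \<in> C" if cC: "c \<in> C" for c
  proof -
    obtain x y where "x \<in> carrier G" "y \<in> carrier G" "c = com x y"
      using cC unfolding C_def by blast
    then show ?thesis
      using com_inv[of x y] com_mem[of y x] by simp
  qed
  have conj: "g \<otimes> c \<otimes> inv g \<in> C" if cC: "c \<in> C" and g: "g \<in> carrier G" for c g
  proof -
    obtain x y where xy: "x \<in> carrier G" "y \<in> carrier G" "c = com x y"
      using cC unfolding C_def by blast
    then have "g \<otimes> c \<otimes> inv g = com (g \<otimes> x \<otimes> inv g) (g \<otimes> y \<otimes> inv g)"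
      using g by (simp add: com_def G.inv_mult_group G.m_assoc G.mult_inv_cancel)
    then show ?thesis
      using g xy(1,2) com_mem by simp
  qed
  have shorten: "\<exists>vs. set vs \<subseteq> C \<and> length vs = m \<and> c [^] Suc m = list_mult G vs" if cC: "c \<in> C" for c
  proof -
    obtain x y where xy: "x \<in> carrier G" "y \<in> carrier G" "c = com x y"
      using cC unfolding C_def by blast
    have c: "c \<in> carrier G"
      using xy com_closed by simp
    interpret I: group "H\<lparr>carrier := h ` carrier G\<rparr>"
      using H.subgroup_imp_group[OF img_is_subgroup] .
    have "h c [^]\<^bsub>H\<^esub> m = \<one>\<^bsub>H\<^esub>"
      using I.pow_order_eq_1[of "h c"] c
      by (simp add: order_def m_def H.nat_pow_consistent[symmetric])
    then have "c [^] m \<in> kernel G H h"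
      using c by (simp add: kernel_def hom_nat_pow)
    then have "c [^] m \<otimes> x = x \<otimes> c [^] m"
      by (rule central[OF _ xy(1)])
    then have eq: "c [^] Suc m = list_mult G (replicate (m - 1) (x \<otimes> c \<otimes> inv x) @ [com (x \<otimes> x) y])"
      unfolding xy(3) com_def by (rule G.commutator_power_shorten[OF xy(1,2) m])
    have "com (x \<otimes> x) y \<in> C"
      using xy(1,2) com_mem by simp
    moreover have "x \<otimes> c \<otimes> inv x \<in> C"
      by (rule conj[OF cC xy(1)])
    ultimately show ?thesis
      using m by (intro exI[of _ "replicate (m - 1) (x \<otimes> c \<otimes> inv x) @ [com (x \<otimes> x) y]"] conjI eq)
        (simp_all add: set_replicate_conv_if)
  qed
  have "derived G (carrier G) = generate G C"
    unfolding derived_eq_rel_commutator rel_commutator_def C_def com_def ..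
  then show ?thesis
    using G.finite_generate_if_powers_shorten[OF finC C inv conj shorten] by simp
qed

section \<open>Powers of a group and the subgroup K\<close>

lemma carrier_power_group: "carrier (power_group G n) = {1..n} \<rightarrow>\<^sub>E carrier G"
  by (simp add: power_group_def)

lemma mult_power_group: "f \<otimes>\<^bsub>power_group G n\<^esub> g = (\<lambda>i\<in>{1..n}. f i \<otimes>\<^bsub>G\<^esub> g i)"
  by (simp add: power_group_def)

lemma one_power_group: "\<one>\<^bsub>power_group G n\<^esub> = (\<lambda>i\<in>{1..n}. \<one>\<^bsub>G\<^esub>)"
  by (simp add: power_group_def)

definition coord_prod :: "('a, 'b) monoid_scheme \<Rightarrow> nat \<Rightarrow> (nat \<Rightarrow> 'a) \<Rightarrow> 'a" where
  "coord_prod G n f = list_mult G (map f [1..<Suc n])"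

definition coord_embed :: "('a, 'b) monoid_scheme \<Rightarrow> nat \<Rightarrow> nat \<Rightarrow> 'a \<Rightarrow> nat \<Rightarrow> 'a" where
  "coord_embed G n i x = (\<lambda>j\<in>{1..n}. if j = i then x else \<one>\<^bsub>G\<^esub>)"

context group
begin

lemma power_group_group: "group (power_group G n)"
  unfolding power_group_def by (rule product_group) (rule group_axioms)

lemma inv_power_group:
  "f \<in> carrier (power_group G n) \<Longrightarrow> inv\<^bsub>power_group G n\<^esub> f = (\<lambda>i\<in>{1..n}. inv f i)"
  unfolding power_group_def by (rule inv_product_group) (simp_all add: group_axioms)

lemma proj_hom: "i \<in> {1..n} \<Longrightarrow> (\<lambda>f. f i) \<in> hom (power_group G n) G"
  by (auto simp: hom_def carrier_power_group mult_power_group)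

lemma coord_closed: "f \<in> carrier (power_group G n) \<Longrightarrow> i \<in> {1..n} \<Longrightarrow> f i \<in> carrier G"
  by (auto simp: carrier_power_group)

lemma coord_prod_closed: "f \<in> carrier (power_group G n) \<Longrightarrow> coord_prod G n f \<in> carrier G"
  unfolding coord_prod_def by (rule list_mult_closed) (auto simp: carrier_power_group)

lemma coord_embed_closed: "x \<in> carrier G \<Longrightarrow> coord_embed G n i x \<in> carrier (power_group G n)"
  by (simp add: coord_embed_def carrier_power_group)

lemma coord_embed_hom: "coord_embed G n i \<in> hom G (power_group G n)"
  by (auto simp: hom_def coord_embed_closed) (auto simp: coord_embed_def mult_power_group fun_eq_iff)

lemma coord_prod_coord_embed:
  assumes "i \<in> {1..n}" "x \<in> carrier G"
  shows "coord_prod G n (coord_embed G n i x) = x"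
proof -
  have "map (coord_embed G n i x) [1..<Suc n] = map (\<lambda>j. if j = i then x else \<one>) [1..<Suc n]"
    by (simp add: coord_embed_def del: upt_Suc)
  then show ?thesis
    unfolding coord_prod_def using assms by (simp only: list_mult_single distinct_upt) auto
qed

lemma coord_prod_coord_embed_mult:
  assumes "n \<ge> 1" "x \<in> carrier G" "f \<in> carrier (power_group G n)"
  shows "coord_prod G n (coord_embed G n 1 x \<otimes>\<^bsub>power_group G n\<^esub> f) = x \<otimes> coord_prod G n f"
proof -
  have split: "[1..<Suc n] = 1 # [2..<Suc n]"
    using assms(1) by (simp add: upt_conv_Cons numeral_2_eq_2 del: upt_Suc)
  have tail: "map (coord_embed G n 1 x \<otimes>\<^bsub>power_group G n\<^esub> f) [2..<Suc n] = map f [2..<Suc n]"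
    using assms(3) by (auto simp: mult_power_group coord_embed_def coord_closed)
  have "list_mult G (map f [2..<Suc n]) \<in> carrier G"
    by (rule list_mult_closed) (use assms(3) in \<open>auto simp: coord_closed\<close>)
  moreover have "f 1 \<in> carrier G"
    using assms(1,3) by (simp add: coord_closed)
  ultimately show ?thesis
    using assms(1,2) unfolding coord_prod_def split list.map tail
    by (simp add: mult_power_group coord_embed_def m_assoc del: upt_Suc)
qed

lemma K_subgroup_eq:
  "K_subgroup G n = {f \<in> carrier (power_group G n). coord_prod G n f \<in> derived G (carrier G)}"
proof -
  have D: "subgroup (derived G (carrier G)) G"
    by (rule derived_is_subgroup) simp
  have "derived G (carrier G) #> x = derived G (carrier G) \<longleftrightarrow> x \<in> derived G (carrier G)"
    if "x \<in> carrier G" for x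
    using that D by (metis coset_join1 coset_join2 subgroup.subset)
  then show ?thesis
    unfolding K_subgroup_def kernel_def abelianization_def coord_prod_def[symmetric]
    by (intro Collect_cong conj_cong refl) (simp add: coord_prod_closed)
qed

end

lemma (in group_hom) hom_coord_prod:
  assumes "f \<in> carrier (power_group G n)"
  shows "h (coord_prod G n f) = list_mult H (map (\<lambda>i. h (f i)) [1..<Suc n])"
  unfolding coord_prod_def
  by (subst hom_list_mult) (use assms in \<open>auto simp: G.coord_closed comp_def simp del: upt_Suc\<close>)

lemma (in group_hom) hom_coord_prod_cong:
  assumes "f \<in> carrier (power_group G n)" "g \<in> carrier (power_group G n)"
    and "\<And>i. i \<in> {1..n} \<Longrightarrow> h (f i) = h (g i)"
  shows "h (coord_prod G n f) = h (coord_prod G n g)"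
  unfolding hom_coord_prod[OF assms(1)] hom_coord_prod[OF assms(2)]
  by (intro arg_cong[of _ _ "list_mult H"] map_cong refl) (use assms(3) in auto)

lemma (in subgroup) list_mult_mem: "set xs \<subseteq> H \<Longrightarrow> list_mult G xs \<in> H"
  by (induction xs) auto

lemma (in subgroup) coord_prod_mem:
  assumes "\<And>i. i \<in> {1..n} \<Longrightarrow> f i \<in> H"
  shows "coord_prod G n f \<in> H"
  unfolding coord_prod_def by (rule list_mult_mem) (use assms in \<open>auto simp del: upt_Suc\<close>)

text \<open>The product of the coordinates is not a homomorphism in general, but it
  becomes multiplicative in a group where the coordinates of the second factor are central.\<close>

lemma (in group_hom) hom_coord_prod_mult_central:
  assumes "f \<in> carrier (power_group G n)" "g \<in> carrier (power_group G n)"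
    and central: "\<And>i y. i \<in> {1..n} \<Longrightarrow> y \<in> carrier H \<Longrightarrow> h (g i) \<otimes>\<^bsub>H\<^esub> y = y \<otimes>\<^bsub>H\<^esub> h (g i)"
  shows "h (coord_prod G n (f \<otimes>\<^bsub>power_group G n\<^esub> g)) = h (coord_prod G n f) \<otimes>\<^bsub>H\<^esub> h (coord_prod G n g)"
proof -
  have "f \<otimes>\<^bsub>power_group G n\<^esub> g \<in> carrier (power_group G n)"
    by (rule monoid.m_closed[OF group.is_monoid[OF G.power_group_group]]) fact+
  then have "h (coord_prod G n (f \<otimes>\<^bsub>power_group G n\<^esub> g))
      = list_mult H (map (\<lambda>i. h ((f \<otimes>\<^bsub>power_group G n\<^esub> g) i)) [1..<Suc n])"
    by (rule hom_coord_prod)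
  also have "\<dots> = list_mult H (map (\<lambda>i. h (f i) \<otimes>\<^bsub>H\<^esub> h (g i)) [1..<Suc n])"
    using assms(1,2)
    by (intro arg_cong[of _ _ "list_mult H"] map_cong refl)
      (auto simp: mult_power_group G.coord_closed simp del: upt_Suc)
  also have "\<dots> = list_mult H (map (\<lambda>i. h (f i)) [1..<Suc n]) \<otimes>\<^bsub>H\<^esub> list_mult H (map (\<lambda>i. h (g i)) [1..<Suc n])"
    using assms by (intro H.list_mult_mult_central) (auto simp: G.coord_closed simp del: upt_Suc)
  also have "\<dots> = h (coord_prod G n f) \<otimes>\<^bsub>H\<^esub> h (coord_prod G n g)"
    using assms(1,2) by (simp only: hom_coord_prod)
  finally show ?thesis .
qed

context group
begin

text \<open>Over the abelianization the product of the coordinates is a homomorphism, whose kernel is \<open>\<K>(G,n)\<close>.\<close>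

lemma K_subgroup_normal: "K_subgroup G n \<lhd> power_group G n"
proof -
  interpret P: group "power_group G n"
    by (rule power_group_group)
  interpret D: normal "derived G (carrier G)" G
    by (rule derived_self_is_normal)
  interpret A: comm_group "abelianization G"
    unfolding abelianization_def by (rule derived_quot_is_comm_group)
  interpret q: group_hom G "abelianization G" "\<lambda>x. derived G (carrier G) #> x"
    using D.r_coset_hom_Mod by unfold_locales (simp add: abelianization_def)
  have "group_hom (power_group G n) (abelianization G) (\<lambda>f. derived G (carrier G) #> coord_prod G n f)"
  proof (unfold_locales, rule homI)
    fix f g
    assume fg: "f \<in> carrier (power_group G n)" "g \<in> carrier (power_group G n)"
    show "derived G (carrier G) #> coord_prod G n (f \<otimes>\<^bsub>power_group G n\<^esub> g)
        = (derived G (carrier G) #> coord_prod G n f) \<otimes>\<^bsub>abelianization G\<^esub> (derived G (carrier G) #> coord_prod G n g)"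
      by (rule q.hom_coord_prod_mult_central[OF fg]) (rule A.m_comm[OF q.hom_closed[OF coord_closed[OF fg(2)]]])
  qed (rule q.hom_closed[OF coord_prod_closed])
  then show ?thesis
    unfolding K_subgroup_def coord_prod_def[symmetric] by (rule group_hom.normal_kernel)
qed

lemma coord_embed_derived_mem_K_subgroup:
  assumes "i \<in> {1..n}" "x \<in> derived G (carrier G)"
  shows "coord_embed G n i x \<in> K_subgroup G n"
proof -
  have "x \<in> carrier G"
    using assms(2) derived_in_carrier by blast
  then show ?thesis
    using assms by (simp add: K_subgroup_eq coord_embed_closed coord_prod_coord_embed)
qed

lemma mem_subgroup_if_embedded_coords:
  assumes M: "subgroup M (power_group G n)" and f: "f \<in> carrier (power_group G n)"
    and emb: "\<And>i. i \<in> {1..n} \<Longrightarrow> coord_embed G n i (f i) \<in> M"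
  shows "f \<in> M"
proof -
  have "(\<lambda>i\<in>{1..n}. if i \<le> k then f i else \<one>) \<in> M" if "k \<le> n" for k
    using that
  proof (induction k)
    case 0
    have eq: "(\<lambda>i\<in>{1..n}. if i \<le> 0 then f i else \<one>) = \<one>\<^bsub>power_group G n\<^esub>"
      unfolding one_power_group by (rule restrict_ext) simp
    show ?case
      unfolding eq by (rule subgroup.one_closed[OF M])
  next
    case (Suc k)
    have eq: "(\<lambda>i\<in>{1..n}. if i \<le> Suc k then f i else \<one>)
        = (\<lambda>i\<in>{1..n}. if i \<le> k then f i else \<one>) \<otimes>\<^bsub>power_group G n\<^esub> coord_embed G n (Suc k) (f (Suc k))"
      unfolding mult_power_group
    proof (rule restrict_ext)
      fix i
      assume i: "i \<in> {1..n}"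
      then have "f i \<in> carrier G"
        by (rule coord_closed[OF f])
      then show "(if i \<le> Suc k then f i else \<one>)
          = (\<lambda>i\<in>{1..n}. if i \<le> k then f i else \<one>) i \<otimes> coord_embed G n (Suc k) (f (Suc k)) i"
        using i by (cases "i = Suc k") (auto simp: coord_embed_def le_Suc_eq)
    qed
    show ?case
      unfolding eq by (rule subgroup.m_closed[OF M Suc.IH emb]) (use Suc.prems in auto)
  qed
  from this[OF order_refl] have "(\<lambda>i\<in>{1..n}. if i \<le> n then f i else \<one>) \<in> M" .
  also have "(\<lambda>i\<in>{1..n}. if i \<le> n then f i else \<one>) = (\<lambda>i\<in>{1..n}. f i)"
    by (rule restrict_ext) simp
  also have "\<dots> = f"
    using f unfolding carrier_power_group by (rule PiE_restrict)
  finally show ?thesis .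
qed

end

section \<open>The normal closure of K(N,n) in the power of F\<close>

text \<open>The central extension \<open>E = F/[F,N]\<close> enters only through a surjection \<open>\<rho>\<close> with kernel \<open>[F,N]\<close>, so
  that its elements need not be handled as cosets.\<close>

locale central_presentation = \<pi>: group_hom F G \<pi> + \<rho>: group_hom F E \<rho>
  for F :: "('f, 'c) monoid_scheme" and G :: "('a, 'b) monoid_scheme"
    and E :: "('e, 'd) monoid_scheme" and \<pi> \<rho> +
  fixes n :: nat
  assumes \<pi>_surj: "\<pi> ` carrier F = carrier G" and \<rho>_surj: "\<rho> ` carrier F = carrier E"
    and kernel_\<rho>: "kernel F E \<rho> = rel_commutator F (kernel F G \<pi>) (carrier F)"
    and n: "n \<ge> 2"
begin

abbreviation N where "N \<equiv> kernel F G \<pi>"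
abbreviation R where "R \<equiv> kernel F E \<rho>"
abbreviation P where "P \<equiv> power_group F n"
abbreviation K where "K \<equiv> K_subgroup F n"
abbreviation prd where "prd \<equiv> coord_prod F n"
abbreviation L where "L \<equiv> normal_closure P (K_subgroup (F\<lparr>carrier := N\<rparr>) n)"

sublocale N: normal N F
  by (rule \<pi>.normal_kernel)

sublocale P: group P
  by (rule \<pi>.G.power_group_group)

sublocale R: normal R F
  by (rule \<rho>.normal_kernel)

sublocale K: normal K P
  by (rule \<pi>.G.K_subgroup_normal)

lemma R_subset_N: "R \<subseteq> N"
  unfolding kernel_\<rho>
proof (rule \<pi>.G.rel_commutator_least[OF N.subgroup_axioms])
  show "x \<otimes>\<^bsub>F\<^esub> y \<otimes>\<^bsub>F\<^esub> inv\<^bsub>F\<^esub> x \<otimes>\<^bsub>F\<^esub> inv\<^bsub>F\<^esub> y \<in> N" if "x \<in> N" "y \<in> carrier F" for x y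
    using that unfolding kernel_def by simp
qed

lemma R_subset_derived: "R \<subseteq> derived F (carrier F)"
  unfolding kernel_\<rho> derived_eq_rel_commutator by (rule \<pi>.G.rel_commutator_mono[OF N.subset subset_refl])

lemma \<rho>_eq_one_iff: "x \<in> carrier F \<Longrightarrow> \<rho> x = \<one>\<^bsub>E\<^esub> \<longleftrightarrow> x \<in> R"
  unfolding kernel_def by simp

lemma \<rho>_central:
  assumes "z \<in> N" "y \<in> carrier E"
  shows "\<rho> z \<otimes>\<^bsub>E\<^esub> y = y \<otimes>\<^bsub>E\<^esub> \<rho> z"
proof -
  obtain x where x: "x \<in> carrier F" "y = \<rho> x"
    using assms(2) unfolding \<rho>_surj[symmetric] by (elim imageE)
  have z: "z \<in> carrier F"
    by (rule N.mem_carrier[OF assms(1)])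
  have "z \<otimes>\<^bsub>F\<^esub> x \<otimes>\<^bsub>F\<^esub> inv\<^bsub>F\<^esub> z \<otimes>\<^bsub>F\<^esub> inv\<^bsub>F\<^esub> x \<in> R"
    unfolding kernel_\<rho> by (rule \<pi>.G.rel_commutator_incl[OF assms(1) x(1)])
  then have "\<rho> z \<otimes>\<^bsub>E\<^esub> \<rho> x \<otimes>\<^bsub>E\<^esub> inv\<^bsub>E\<^esub> \<rho> z \<otimes>\<^bsub>E\<^esub> inv\<^bsub>E\<^esub> \<rho> x = \<one>\<^bsub>E\<^esub>"
    using z x(1) unfolding kernel_def by simp
  then show ?thesis
    unfolding x(2) using z x(1) by (simp add: \<rho>.H.commutator_eq_one_iff)
qed

lemma prd_mult:
  assumes "f \<in> carrier P" "g \<in> carrier P" "\<And>i. i \<in> {1..n} \<Longrightarrow> g i \<in> N"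
  shows "\<rho> (prd (f \<otimes>\<^bsub>P\<^esub> g)) = \<rho> (prd f) \<otimes>\<^bsub>E\<^esub> \<rho> (prd g)"
  by (rule \<rho>.hom_coord_prod_mult_central[OF assms(1,2)]) (rule \<rho>_central[OF assms(3)])

text \<open>The explicit form of the normal closure of \<open>\<K>(N,n)\<close>; see \<open>L_eq_balanced\<close>.\<close>

definition balanced where
  "balanced = {f \<in> carrier P. (\<forall>i\<in>{1..n}. f i \<in> N) \<and> \<rho> (prd f) = \<one>\<^bsub>E\<^esub>}"

lemma mem_balanced_if_coords_in_R:
  assumes "f \<in> carrier P" "\<And>i. i \<in> {1..n} \<Longrightarrow> f i \<in> R"
  shows "f \<in> balanced"
proof -
  have "prd f \<in> R"
    by (rule R.coord_prod_mem) (rule assms(2))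
  then show ?thesis
    unfolding balanced_def using assms R_subset_N by (auto simp: \<rho>_eq_one_iff \<pi>.G.coord_prod_closed)
qed

lemma balanced_subgroup: "subgroup balanced P"
proof (rule P.subgroupI)
  have "\<one>\<^bsub>P\<^esub> \<in> balanced"
  proof (rule mem_balanced_if_coords_in_R[OF P.one_closed])
    show "\<one>\<^bsub>P\<^esub> i \<in> R" if "i \<in> {1..n}" for i
      using that by (simp add: one_power_group R.one_closed)
  qed
  then show "balanced \<noteq> {}"
    by blast
  fix f assume f: "f \<in> balanced"
  then have fP: "f \<in> carrier P" and fN: "\<And>i. i \<in> {1..n} \<Longrightarrow> f i \<in> N" and f1: "\<rho> (prd f) = \<one>\<^bsub>E\<^esub>"
    unfolding balanced_def by blast+
  have invN: "(inv\<^bsub>P\<^esub> f) i \<in> N" if "i \<in> {1..n}" for i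
    using that fN[OF that] fP by (simp add: \<pi>.G.inv_power_group)
  have "prd \<one>\<^bsub>P\<^esub> \<in> R"
    by (rule R.coord_prod_mem) (simp add: one_power_group R.one_closed)
  then have "\<one>\<^bsub>E\<^esub> = \<rho> (prd (f \<otimes>\<^bsub>P\<^esub> inv\<^bsub>P\<^esub> f))"
    using fP \<rho>_eq_one_iff[OF \<pi>.G.coord_prod_closed[OF P.one_closed]] by simp
  also have "\<dots> = \<rho> (prd (inv\<^bsub>P\<^esub> f))"
    using prd_mult[OF fP P.inv_closed[OF fP] invN] fP by (simp add: f1 \<pi>.G.coord_prod_closed)
  finally show "inv\<^bsub>P\<^esub> f \<in> balanced"
    unfolding balanced_def using fP invN by auto
  fix g assume g: "g \<in> balanced"
  then have gP: "g \<in> carrier P" and gN: "\<And>i. i \<in> {1..n} \<Longrightarrow> g i \<in> N" and g1: "\<rho> (prd g) = \<one>\<^bsub>E\<^esub>"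
    unfolding balanced_def by blast+
  have "\<rho> (prd (f \<otimes>\<^bsub>P\<^esub> g)) = \<one>\<^bsub>E\<^esub>"
    using prd_mult[OF fP gP gN] by (simp add: f1 g1)
  moreover have "(f \<otimes>\<^bsub>P\<^esub> g) i \<in> N" if "i \<in> {1..n}" for i
    using that fN[OF that] gN[OF that] by (simp add: mult_power_group)
  ultimately show "f \<otimes>\<^bsub>P\<^esub> g \<in> balanced"
    unfolding balanced_def using fP gP by auto
qed (auto simp: balanced_def)

text \<open>The coordinates of the commutator lie in \<open>[N,F] = R\<close>. This yields both the normality of
  \<open>balanced\<close> and, later, the centrality of \<open>N\<^sup>n \<inter> \<K>(F,n)\<close> modulo \<open>L\<close>.\<close>

lemma commutator_mem_balanced:
  assumes "f \<in> carrier P" "\<And>i. i \<in> {1..n} \<Longrightarrow> f i \<in> N" "g \<in> carrier P"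
  shows "f \<otimes>\<^bsub>P\<^esub> g \<otimes>\<^bsub>P\<^esub> inv\<^bsub>P\<^esub> f \<otimes>\<^bsub>P\<^esub> inv\<^bsub>P\<^esub> g \<in> balanced"
proof (rule mem_balanced_if_coords_in_R)
  fix i assume i: "i \<in> {1..n}"
  have "f i \<otimes>\<^bsub>F\<^esub> g i \<otimes>\<^bsub>F\<^esub> inv\<^bsub>F\<^esub> (f i) \<otimes>\<^bsub>F\<^esub> inv\<^bsub>F\<^esub> (g i) \<in> R"
    unfolding kernel_\<rho> by (intro \<pi>.G.rel_commutator_incl assms(2) i \<pi>.G.coord_closed[OF assms(3)])
  then show "(f \<otimes>\<^bsub>P\<^esub> g \<otimes>\<^bsub>P\<^esub> inv\<^bsub>P\<^esub> f \<otimes>\<^bsub>P\<^esub> inv\<^bsub>P\<^esub> g) i \<in> R"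
    using i assms(1,3) by (simp add: mult_power_group \<pi>.G.inv_power_group)
qed (use assms in auto)

lemma balanced_normal: "balanced \<lhd> P"
proof (rule P.normal_invI[OF balanced_subgroup])
  fix g f assume g: "g \<in> carrier P" and f: "f \<in> balanced"
  then have fP: "f \<in> carrier P" and fN: "\<And>i. i \<in> {1..n} \<Longrightarrow> f i \<in> N"
    unfolding balanced_def by blast+
  have "inv\<^bsub>P\<^esub> (f \<otimes>\<^bsub>P\<^esub> g \<otimes>\<^bsub>P\<^esub> inv\<^bsub>P\<^esub> f \<otimes>\<^bsub>P\<^esub> inv\<^bsub>P\<^esub> g) \<otimes>\<^bsub>P\<^esub> f \<in> balanced"
    by (intro subgroup.m_closed[OF balanced_subgroup _ f] subgroup.m_inv_closed[OF balanced_subgroup] commutator_mem_balanced fP fN g)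
  then show "g \<otimes>\<^bsub>P\<^esub> f \<otimes>\<^bsub>P\<^esub> inv\<^bsub>P\<^esub> g \<in> balanced"
    using fP g by (simp add: P.inv_mult_group P.m_assoc)
qed

lemma K_subgroup_N_eq:
  "K_subgroup (F\<lparr>carrier := N\<rparr>) n
    = {f \<in> carrier P. (\<forall>i\<in>{1..n}. f i \<in> N) \<and> prd f \<in> derived F N}"
proof -
  interpret FN: group "F\<lparr>carrier := N\<rparr>"
    by (rule \<pi>.G.subgroup_imp_group[OF N.subgroup_axioms])
  have "derived (F\<lparr>carrier := N\<rparr>) N = derived F N"
    by (rule \<pi>.G.derived_consistent[OF subset_refl N.subgroup_axioms])
  moreover have "coord_prod (F\<lparr>carrier := N\<rparr>) n f = prd f" for f
    by (simp add: coord_prod_def list_mult_def)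
  moreover have "f \<in> carrier (power_group (F\<lparr>carrier := N\<rparr>) n) \<longleftrightarrow> f \<in> carrier P \<and> (\<forall>i\<in>{1..n}. f i \<in> N)" for f
    unfolding carrier_power_group PiE_iff using N.subset by auto
  ultimately show ?thesis
    unfolding FN.K_subgroup_eq by auto
qed

text \<open>For the inclusion of \<open>balanced\<close> in \<open>L\<close>, a normal subgroup \<open>M\<close> that contains \<open>\<K>(N,n)\<close> also contains
  \<open>(z, 1, \<dots>, 1)\<close> for all \<open>z \<in> R\<close>. Dividing a balanced tuple by \<open>(z, 1, \<dots>, 1)\<close>, where \<open>z\<close> is its
  product, leaves a tuple with product \<open>1\<close>, which lies in \<open>\<K>(N,n)\<close>.\<close>

lemma L_eq_balanced: "L = balanced"
proof
  have "derived F N \<subseteq> R"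
    unfolding kernel_\<rho> derived_eq_rel_commutator by (rule \<pi>.G.rel_commutator_mono) (use N.subset in auto)
  then have "K_subgroup (F\<lparr>carrier := N\<rparr>) n \<subseteq> balanced"
    unfolding K_subgroup_N_eq balanced_def by (auto simp: \<rho>_eq_one_iff \<pi>.G.coord_prod_closed)
  then show "L \<subseteq> balanced"
    unfolding normal_closure_def using balanced_normal by blast
next
  have "balanced \<subseteq> M" if M: "M \<lhd> P" and sub: "K_subgroup (F\<lparr>carrier := N\<rparr>) n \<subseteq> M" for M
  proof -
    interpret M: normal M P by fact
    have d1: "\<one>\<^bsub>F\<^esub> \<in> derived F N"
      by (rule subgroup.one_closed[OF \<pi>.G.derived_is_subgroup]) (rule N.subset)
    interpret e: group_hom F P "coord_embed F n 1"
      using \<pi>.G.coord_embed_hom by unfold_locales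
    have com: "coord_embed F n 1 (x \<otimes>\<^bsub>F\<^esub> y \<otimes>\<^bsub>F\<^esub> inv\<^bsub>F\<^esub> x \<otimes>\<^bsub>F\<^esub> inv\<^bsub>F\<^esub> y) \<in> M" if x: "x \<in> N" and y: "y \<in> carrier F" for x y
    proof -
      have xF: "x \<in> carrier F"
        using x by simp
      \<comment> \<open>The inverse in the second coordinate puts the tuple in \<open>\<K>(N,n)\<close>, and conjugating by \<open>?y\<close> leaves that coordinate alone.\<close>
      let ?k = "coord_embed F n 1 x \<otimes>\<^bsub>P\<^esub> coord_embed F n 2 (inv\<^bsub>F\<^esub> x)"
      let ?y = "coord_embed F n 1 y"
      have emb: "coord_embed F n i z \<in> carrier P" if "z \<in> carrier F" for i z
        by (rule \<pi>.G.coord_embed_closed[OF that])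
      have k: "?k \<in> carrier P"
        by (intro P.m_closed emb xF \<pi>.G.inv_closed)
      have "prd ?k = \<one>\<^bsub>F\<^esub>"
        using n xF by (simp add: \<pi>.G.coord_prod_coord_embed_mult \<pi>.G.coord_prod_coord_embed emb del: One_nat_def)
      moreover have "?k i \<in> N" if "i \<in> {1..n}" for i
        using that x xF by (auto simp: mult_power_group coord_embed_def)
      ultimately have kM: "?k \<in> M"
        using sub k d1 unfolding K_subgroup_N_eq by auto
      have "?k \<otimes>\<^bsub>P\<^esub> (?y \<otimes>\<^bsub>P\<^esub> inv\<^bsub>P\<^esub> ?k \<otimes>\<^bsub>P\<^esub> inv\<^bsub>P\<^esub> ?y) \<in> M"
        by (rule M.m_closed[OF kM M.inv_op_closed2[OF emb[OF y] M.m_inv_closed[OF kM]]])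
      moreover have "?k \<otimes>\<^bsub>P\<^esub> (?y \<otimes>\<^bsub>P\<^esub> inv\<^bsub>P\<^esub> ?k \<otimes>\<^bsub>P\<^esub> inv\<^bsub>P\<^esub> ?y)
          = coord_embed F n 1 (x \<otimes>\<^bsub>F\<^esub> y \<otimes>\<^bsub>F\<^esub> inv\<^bsub>F\<^esub> x \<otimes>\<^bsub>F\<^esub> inv\<^bsub>F\<^esub> y)"
        unfolding \<pi>.G.inv_power_group[OF k] \<pi>.G.inv_power_group[OF emb[OF y]] using xF y
        by (auto simp: mult_power_group coord_embed_def fun_eq_iff \<pi>.G.m_assoc)
      ultimately show ?thesis
        by simp
    qed
    have RM: "coord_embed F n 1 ` R \<subseteq> M"
    proof -
      have "subgroup {x \<in> carrier F. coord_embed F n 1 x \<in> M} F"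
        by (rule subgroup.intro) (auto simp del: One_nat_def)
      then have "R \<subseteq> {x \<in> carrier F. coord_embed F n 1 x \<in> M}"
        unfolding kernel_\<rho> by (rule \<pi>.G.rel_commutator_least) (use com in \<open>simp del: One_nat_def\<close>)
      then show ?thesis
        by blast
    qed
    show "balanced \<subseteq> M"
    proof
      fix f assume f: "f \<in> balanced"
      then have fP: "f \<in> carrier P" and fN: "\<And>i. i \<in> {1..n} \<Longrightarrow> f i \<in> N" and "\<rho> (prd f) = \<one>\<^bsub>E\<^esub>"
        unfolding balanced_def by blast+
      then have z: "prd f \<in> R"
        using \<rho>_eq_one_iff[OF \<pi>.G.coord_prod_closed[OF fP]] by blast
      have zF: "prd f \<in> carrier F" and zN: "prd f \<in> N"
        using z R_subset_N by auto
      let ?k = "coord_embed F n 1 (inv\<^bsub>F\<^esub> prd f) \<otimes>\<^bsub>P\<^esub> f"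
      have "prd ?k = inv\<^bsub>F\<^esub> prd f \<otimes>\<^bsub>F\<^esub> prd f"
        by (rule \<pi>.G.coord_prod_coord_embed_mult[OF _ \<pi>.G.inv_closed[OF zF] fP]) (use n in simp)
      then have "prd ?k = \<one>\<^bsub>F\<^esub>"
        using zF by simp
      moreover have "?k \<in> carrier P"
        by (intro P.m_closed fP \<pi>.G.coord_embed_closed \<pi>.G.inv_closed zF)
      moreover have "?k i \<in> N" if "i \<in> {1..n}" for i
        using that zN zF fN[OF that] by (auto simp: mult_power_group coord_embed_def)
      ultimately have "?k \<in> M"
        using sub d1 unfolding K_subgroup_N_eq by auto
      then have "coord_embed F n 1 (prd f) \<otimes>\<^bsub>P\<^esub> ?k \<in> M"
        by (rule M.m_closed[OF subsetD[OF RM imageI[OF z]]])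
      moreover have "coord_embed F n 1 (prd f) \<otimes>\<^bsub>P\<^esub> ?k = f"
        using zF fP by (simp add: P.mult_inv_cancel del: One_nat_def)
      ultimately show "f \<in> M"
        by simp
    qed
  qed
  then show "balanced \<subseteq> L"
    unfolding normal_closure_def by blast
qed

section \<open>The quotient of K(F,n) as a central extension\<close>

abbreviation q where "q f \<equiv> L #>\<^bsub>P\<^esub> f"
abbreviation Q where "Q \<equiv> K_tilde F N n"

lemma mem_L_iff:
  "f \<in> L \<longleftrightarrow> f \<in> carrier P \<and> (\<forall>i\<in>{1..n}. f i \<in> N) \<and> \<rho> (prd f) = \<one>\<^bsub>E\<^esub>"
  unfolding L_eq_balanced balanced_def by blast

sublocale L: normal L P
  unfolding L_eq_balanced by (rule balanced_normal)

lemma q_eqI: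
  assumes "f \<in> carrier P" "g \<in> carrier P" "f \<otimes>\<^bsub>P\<^esub> inv\<^bsub>P\<^esub> g \<in> L"
  shows "q f = q g"
proof (rule P.repr_independence[symmetric, OF _ assms(2) L.subgroup_axioms])
  have "f = (f \<otimes>\<^bsub>P\<^esub> inv\<^bsub>P\<^esub> g) \<otimes>\<^bsub>P\<^esub> g"
    using assms(1,2) by (simp add: P.m_assoc)
  then show "f \<in> L #>\<^bsub>P\<^esub> g"
    using assms(3) unfolding r_coset_def by blast
qed

text \<open>With \<open>f = g z\<close>, equality of the coordinates modulo \<open>N\<close> puts \<open>z\<close> in \<open>N\<^sup>n\<close>, so its coordinates are central modulo
  \<open>R\<close>, and comparing the products of \<open>f\<close> and \<open>g\<close> shows that the product of \<open>z\<close> is trivial modulo \<open>R\<close>.\<close>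

lemma q_eq_if_same_invariants:
  assumes f: "f \<in> carrier P" and g: "g \<in> carrier P"
    and \<pi>: "\<And>i. i \<in> {1..n} \<Longrightarrow> \<pi> (f i) = \<pi> (g i)" and \<rho>: "\<rho> (prd f) = \<rho> (prd g)"
  shows "q f = q g"
proof (rule q_eqI[OF f g])
  let ?z = "inv\<^bsub>P\<^esub> g \<otimes>\<^bsub>P\<^esub> f"
  have z: "?z \<in> carrier P"
    using f g by simp
  have zN: "?z i \<in> N" if i: "i \<in> {1..n}" for i
  proof -
    have "f i \<in> carrier F" "g i \<in> carrier F"
      by (rule \<pi>.G.coord_closed[OF f i], rule \<pi>.G.coord_closed[OF g i])
    then have "inv\<^bsub>F\<^esub> (g i) \<otimes>\<^bsub>F\<^esub> f i \<in> N"
      using \<pi>[OF i] unfolding kernel_def by simp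
    then show ?thesis
      using i g by (simp add: mult_power_group \<pi>.G.inv_power_group)
  qed
  have fz: "f = g \<otimes>\<^bsub>P\<^esub> ?z"
    using f g by (simp add: P.mult_inv_cancel)
  have "\<rho> (prd g) = \<rho> (prd g) \<otimes>\<^bsub>E\<^esub> \<rho> (prd ?z)"
    using prd_mult[OF g z zN] fz \<rho> by simp
  then have "\<rho> (prd ?z) = \<one>\<^bsub>E\<^esub>"
    using g z \<rho>.H.l_cancel_one'[of "\<rho> (prd g)" "\<rho> (prd ?z)"] by (simp add: \<pi>.G.coord_prod_closed)
  then have "?z \<in> L"
    unfolding mem_L_iff using z zN by blast
  then have "g \<otimes>\<^bsub>P\<^esub> ?z \<otimes>\<^bsub>P\<^esub> inv\<^bsub>P\<^esub> g \<in> L"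
    by (rule L.inv_op_closed2[OF g])
  then show "f \<otimes>\<^bsub>P\<^esub> inv\<^bsub>P\<^esub> g \<in> L"
    by (simp only: fz[symmetric])
qed

lemma mem_K_iff: "f \<in> K \<longleftrightarrow> f \<in> carrier P \<and> prd f \<in> derived F (carrier F)"
  unfolding \<pi>.G.K_subgroup_eq by blast

lemma L_subset_K: "L \<subseteq> K"
proof
  fix f assume "f \<in> L"
  then have f: "f \<in> carrier P" "\<rho> (prd f) = \<one>\<^bsub>E\<^esub>"
    unfolding mem_L_iff by simp_all
  then have "prd f \<in> R"
    using \<rho>_eq_one_iff[OF \<pi>.G.coord_prod_closed[OF f(1)]] by simp
  then show "f \<in> K"
    unfolding mem_K_iff using f(1) subsetD[OF R_subset_derived] by simp
qed

sublocale KL: normal L "P\<lparr>carrier := K\<rparr>"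
  by (rule P.normal_restrict_supergroup[OF K.subgroup_axioms L.normal_axioms L_subset_K])

sublocale q: group_hom "P\<lparr>carrier := K\<rparr>" Q q
proof (intro group_hom.intro group_hom_axioms.intro)
  show "group (P\<lparr>carrier := K\<rparr>)"
    by (rule KL.group_axioms)
  show "group Q"
    unfolding K_tilde_def by (rule KL.factorgroup_is_group)
  show "q \<in> hom (P\<lparr>carrier := K\<rparr>) Q"
    using KL.r_coset_hom_Mod unfolding K_tilde_def by simp
qed

lemma carrier_Q: "carrier Q = q ` K"
  unfolding K_tilde_def carrier_FactGroup by simp

lemma coordinate_hom:
  assumes i: "i \<in> {1..n}"
  shows "\<exists>\<sigma>\<in>hom Q G. \<forall>f\<in>K. \<sigma> (q f) = \<pi> (f i)"
proof -
  have "(\<lambda>f. \<pi> (f i)) \<in> hom P G"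
    using hom_compose[OF \<pi>.G.proj_hom[OF i] \<pi>.homh] unfolding comp_def .
  then have "group_hom P G (\<lambda>f. \<pi> (f i))"
    by (intro group_hom.intro group_hom_axioms.intro P.group_axioms \<pi>.H.group_axioms)
  then have hom: "group_hom (P\<lparr>carrier := K\<rparr>) G (\<lambda>f. \<pi> (f i))"
    by (rule group_hom.induced_group_hom'[OF _ K.subgroup_axioms])
  have "L \<subseteq> kernel (P\<lparr>carrier := K\<rparr>) G (\<lambda>f. \<pi> (f i))"
  proof
    fix f assume f: "f \<in> L"
    then have "f i \<in> N"
      using i unfolding mem_L_iff by simp
    then show "f \<in> kernel (P\<lparr>carrier := K\<rparr>) G (\<lambda>f. \<pi> (f i))"
      using subsetD[OF L_subset_K f] unfolding kernel_def by simp
  qed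
  from group_hom.FactGroup_universal_kernel[OF hom KL.normal_axioms this]
  obtain s where "s \<in> hom ((P\<lparr>carrier := K\<rparr>) Mod L) G"
      "\<And>f. f \<in> carrier (P\<lparr>carrier := K\<rparr>) \<Longrightarrow> s (L #>\<^bsub>P\<lparr>carrier := K\<rparr>\<^esub> f) = \<pi> (f i)"
    by metis
  then show ?thesis
    unfolding K_tilde_def by (intro bexI[of _ s] ballI) simp_all
qed

text \<open>The tuple \<open>(x, x\<inverse>, 1, \<dots>, 1)\<close> has product \<open>1\<close> and hence lies in \<open>\<K>(F,n)\<close>.\<close>

lemma coordinate_surj:
  assumes "y \<in> carrier G"
  shows "\<exists>f\<in>K. \<pi> (f 1) = y"
proof -
  obtain x where x: "x \<in> carrier F" "\<pi> x = y"
    using assms unfolding \<pi>_surj[symmetric] by blast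
  let ?f = "coord_embed F n 1 x \<otimes>\<^bsub>P\<^esub> coord_embed F n 2 (inv\<^bsub>F\<^esub> x)"
  have emb: "coord_embed F n i z \<in> carrier P" if "z \<in> carrier F" for i z
    by (rule \<pi>.G.coord_embed_closed[OF that])
  have "prd ?f = \<one>\<^bsub>F\<^esub>"
    using n x by (simp add: \<pi>.G.coord_prod_coord_embed_mult \<pi>.G.coord_prod_coord_embed emb del: One_nat_def)
  then have "?f \<in> K"
    unfolding mem_K_iff using emb x subgroup.one_closed[OF \<pi>.G.derived_is_subgroup[OF subset_refl]] by simp
  moreover have "?f 1 = x"
    using n x by (simp add: mult_power_group coord_embed_def)
  ultimately show ?thesis
    using x(2) by (intro bexI[of _ ?f]) simp_all
qed

section \<open>Transfer of the four properties\<close>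

lemma Q_onto_G: "\<exists>\<sigma>. group_hom Q G \<sigma> \<and> \<sigma> ` carrier Q = carrier G"
proof -
  have "1 \<in> {1..n}"
    using n by simp
  then obtain s where s: "s \<in> hom Q G" "\<And>f. f \<in> K \<Longrightarrow> s (q f) = \<pi> (f 1)"
    using coordinate_hom by blast
  interpret s: group_hom Q G s
    using s(1) by unfold_locales
  have "carrier G \<subseteq> s ` carrier Q"
  proof
    fix y assume "y \<in> carrier G"
    then obtain f where "f \<in> K" "\<pi> (f 1) = y"
      using coordinate_surj by blast
    then show "y \<in> s ` carrier Q"
      unfolding carrier_Q using s(2) by (metis image_eqI)
  qed
  moreover have "s ` carrier Q \<subseteq> carrier G"
    by (rule image_subsetI) (rule s.hom_closed)
  ultimately show ?thesis
    using s.group_hom_axioms by blast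
qed

text \<open>A class that is trivial in every coordinate over \<open>G\<close> is represented by a tuple in \<open>N\<^sup>n\<close>, which
  commutes with every tuple modulo \<open>L\<close>.\<close>

lemma nilpotent_Q: "nilpotent G \<Longrightarrow> nilpotent Q"
  and solvable_Q: "solvable G \<Longrightarrow> solvable Q"
proof -
  obtain s where s: "\<And>i. i \<in> {1..n} \<Longrightarrow> s i \<in> hom Q G"
      "\<And>i f. i \<in> {1..n} \<Longrightarrow> f \<in> K \<Longrightarrow> s i (q f) = \<pi> (f i)"
    using bchoice[of "{1..n}" "\<lambda>i s. s \<in> hom Q G \<and> (\<forall>f\<in>K. s (q f) = \<pi> (f i))"] coordinate_hom by blast
  have central: "u \<otimes>\<^bsub>Q\<^esub> v = v \<otimes>\<^bsub>Q\<^esub> u"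
    if u: "u \<in> carrier Q" and su: "\<And>i. i \<in> {1..n} \<Longrightarrow> s i u = \<one>\<^bsub>G\<^esub>" and v: "v \<in> carrier Q" for u v
  proof -
    obtain f where f: "f \<in> K" "u = q f"
      using u unfolding carrier_Q by blast
    obtain g where g: "g \<in> K" "v = q g"
      using v unfolding carrier_Q by blast
    have fP: "f \<in> carrier P" and gP: "g \<in> carrier P"
      using f(1) g(1) by simp_all
    have fN: "f i \<in> N" if i: "i \<in> {1..n}" for i
      using su[OF i] s(2)[OF i f(1)] \<pi>.G.coord_closed[OF fP i] unfolding f(2) kernel_def by simp
    have "q (f \<otimes>\<^bsub>P\<^esub> g) = q (g \<otimes>\<^bsub>P\<^esub> f)"
    proof (rule q_eqI)
      show "f \<otimes>\<^bsub>P\<^esub> g \<otimes>\<^bsub>P\<^esub> inv\<^bsub>P\<^esub> (g \<otimes>\<^bsub>P\<^esub> f) \<in> L"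
        using commutator_mem_balanced[OF fP fN gP] fP gP unfolding L_eq_balanced
        by (simp add: P.inv_mult_group P.m_assoc)
    qed (use fP gP in auto)
    then show "u \<otimes>\<^bsub>Q\<^esub> v = v \<otimes>\<^bsub>Q\<^esub> u"
      unfolding f(2) g(2) using q.hom_mult[of f g] q.hom_mult[of g f] f(1) g(1) by simp
  qed
  show "nilpotent G \<Longrightarrow> nilpotent Q"
    by (rule nilpotent_if_jointly_central_kernel[OF q.H.group_axioms \<pi>.H.group_axioms s(1) central])
  show "solvable G \<Longrightarrow> solvable Q"
    by (rule solvable_if_jointly_central_kernel[OF q.H.group_axioms \<pi>.H.group_axioms s(1) central])
qed

lemma E_onto_G:
  "\<exists>\<tau>. group_hom E G \<tau> \<and> (\<forall>x\<in>carrier F. \<tau> (\<rho> x) = \<pi> x)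
    \<and> (\<forall>z\<in>kernel E G \<tau>. \<forall>y\<in>carrier E. z \<otimes>\<^bsub>E\<^esub> y = y \<otimes>\<^bsub>E\<^esub> z)"
proof -
  have "\<pi> x = \<pi> y" if xy: "x \<in> carrier F" "y \<in> carrier F" "\<rho> x = \<rho> y" for x y
  proof -
    have "x \<otimes>\<^bsub>F\<^esub> inv\<^bsub>F\<^esub> y \<in> R"
      using xy unfolding kernel_def by simp
    then have "\<pi> (x \<otimes>\<^bsub>F\<^esub> inv\<^bsub>F\<^esub> y) = \<one>\<^bsub>G\<^esub>"
      using R_subset_N unfolding kernel_def by blast
    then have "\<pi> x \<otimes>\<^bsub>G\<^esub> inv\<^bsub>G\<^esub> \<pi> y = \<one>\<^bsub>G\<^esub>"
      using xy by simp
    then show ?thesis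
      using xy by (metis \<pi>.H.inv_closed \<pi>.H.inv_equality \<pi>.H.inv_inv \<pi>.hom_closed)
  qed
  then obtain t where t: "\<And>x. x \<in> carrier F \<Longrightarrow> \<pi> x = t (\<rho> x)"
    using function_factors_left_gen[of "\<lambda>x. x \<in> carrier F" \<rho> \<pi>] by blast
  have hom: "t \<in> hom E G"
  proof (rule homI)
    fix a assume "a \<in> carrier E"
    then obtain x where x: "x \<in> carrier F" "a = \<rho> x"
      unfolding \<rho>_surj[symmetric] by blast
    then show "t a \<in> carrier G"
      using t[of x] \<pi>.hom_closed[of x] by simp
    fix b assume "b \<in> carrier E"
    then obtain y where y: "y \<in> carrier F" "b = \<rho> y"
      unfolding \<rho>_surj[symmetric] by blast
    have "t (a \<otimes>\<^bsub>E\<^esub> b) = t (\<rho> (x \<otimes>\<^bsub>F\<^esub> y))"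
      using x y by simp
    also have "\<dots> = \<pi> x \<otimes>\<^bsub>G\<^esub> \<pi> y"
      using x y t[of "x \<otimes>\<^bsub>F\<^esub> y"] by simp
    finally show "t (a \<otimes>\<^bsub>E\<^esub> b) = t a \<otimes>\<^bsub>G\<^esub> t b"
      using x y t by simp
  qed
  have central: "z \<otimes>\<^bsub>E\<^esub> y = y \<otimes>\<^bsub>E\<^esub> z" if z: "z \<in> kernel E G t" and y: "y \<in> carrier E" for z y
  proof -
    have "z \<in> carrier E" and tz: "t z = \<one>\<^bsub>G\<^esub>"
      using z unfolding kernel_def by blast+
    then obtain x where x: "x \<in> carrier F" "z = \<rho> x"
      unfolding \<rho>_surj[symmetric] by blast
    then have "x \<in> N"
      using tz t[of x] unfolding kernel_def by simp
    then show ?thesis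
      unfolding x(2) by (rule \<rho>_central[OF _ y])
  qed
  have "group_hom E G t"
    using hom by unfold_locales
  then show ?thesis
    using t[symmetric] central by (intro exI[of _ t] conjI ballI)
qed

text \<open>A class is determined by its coordinates in \<open>G\<close> and by the product in \<open>[E,E]\<close>, which is finite by
  Schur's theorem.\<close>

lemma finite_Q:
  assumes fin: "finite (carrier G)"
  shows "finite (carrier Q)"
  unfolding carrier_Q
proof (rule finite_image_if_factors[where t = "\<lambda>f. ((\<lambda>i\<in>{1..n}. \<pi> (f i)), \<rho> (prd f))"])
  obtain t where "group_hom E G t" and t_\<rho>: "\<forall>x\<in>carrier F. t (\<rho> x) = \<pi> x"
    and central: "\<forall>z\<in>kernel E G t. \<forall>y\<in>carrier E. z \<otimes>\<^bsub>E\<^esub> y = y \<otimes>\<^bsub>E\<^esub> z"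
    using E_onto_G by (elim exE conjE)
  interpret t: group_hom E G t
    by fact
  have "t ` carrier E \<subseteq> carrier G"
    by (rule image_subsetI) (rule t.hom_closed)
  then have "finite (t ` carrier E)"
    by (rule finite_subset[OF _ fin])
  then have "finite (derived E (carrier E))"
    by (rule t.finite_derived_if_central_kernel) (rule central[rule_format])
  moreover have "derived E (carrier E) = \<rho> ` derived F (carrier F)"
    using \<rho>.derived_img[OF subset_refl] unfolding \<rho>_surj .
  ultimately have finD: "finite (\<rho> ` derived F (carrier F))"
    by simp
  have "(\<lambda>f. ((\<lambda>i\<in>{1..n}. \<pi> (f i)), \<rho> (prd f))) ` K
      \<subseteq> ({1..n} \<rightarrow>\<^sub>E carrier G) \<times> \<rho> ` derived F (carrier F)"
  proof (rule image_subsetI, intro SigmaI)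
    fix f assume f: "f \<in> K"
    have "\<pi> (f i) \<in> carrier G" if "i \<in> {1..n}" for i
      using f that by (intro \<pi>.hom_closed \<pi>.G.coord_closed[of f n]) simp_all
    then show "(\<lambda>i\<in>{1..n}. \<pi> (f i)) \<in> {1..n} \<rightarrow>\<^sub>E carrier G"
      by simp
    show "\<rho> (prd f) \<in> \<rho> ` derived F (carrier F)"
      using f unfolding mem_K_iff by blast
  qed
  then show "finite ((\<lambda>f. ((\<lambda>i\<in>{1..n}. \<pi> (f i)), \<rho> (prd f))) ` K)"
    by (rule finite_subset) (intro finite_cartesian_product finite_PiE finD fin finite_atLeastAtMost)
next
  fix f g
  assume f: "f \<in> K" and g: "g \<in> K"
    and eq: "((\<lambda>i\<in>{1..n}. \<pi> (f i)), \<rho> (prd f)) = ((\<lambda>i\<in>{1..n}. \<pi> (g i)), \<rho> (prd g))"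
  show "q f = q g"
  proof (rule q_eq_if_same_invariants)
    fix i assume "i \<in> {1..n}"
    then show "\<pi> (f i) = \<pi> (g i)"
      using fun_cong[OF conjunct1[OF eq[unfolded prod.inject]], of i] by simp
  qed (use f g eq in auto)
qed

text \<open>Given \<open>f \<in> \<K>(F,n)\<close>, replace each coordinate by an element of \<open>F''\<close> with the same image in \<open>G\<close>. The
  product then changes by an element of \<open>F'\<close>, which modulo \<open>R\<close> agrees with some \<open>s \<in> F''\<close>, as \<open>[E,E]\<close> is
  perfect. Multiplying the first coordinate by \<open>s\<close> restores the product modulo \<open>R\<close> and, since \<open>s\<close> lies in
  \<open>N\<close>, does not disturb the coordinates modulo \<open>N\<close>.\<close>

lemma perfect_Q:
  assumes perfect: "perfect G"
  shows "perfect Q"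
proof -
  let ?D = "derived F (carrier F)"
  let ?D2 = "derived F ?D"
  have DF: "?D \<subseteq> carrier F"
    by (rule \<pi>.G.derived_in_carrier[OF subset_refl])
  have D2F: "?D2 \<subseteq> carrier F"
    by (rule \<pi>.G.derived_in_carrier[OF DF])
  have D2D: "?D2 \<subseteq> ?D"
    by (rule \<pi>.G.mono_derived[OF DF])
  have \<pi>D: "\<pi> ` ?D = carrier G"
    using \<pi>.derived_img[OF subset_refl] perfect unfolding \<pi>_surj perfect_def by simp
  have \<pi>D2: "\<pi> ` ?D2 = carrier G"
    using \<pi>.derived_img[OF DF] perfect unfolding \<pi>D perfect_def by simp
  obtain t where "group_hom E G t" and t_\<rho>: "\<forall>x\<in>carrier F. t (\<rho> x) = \<pi> x"
    and central: "\<forall>z\<in>kernel E G t. \<forall>y\<in>carrier E. z \<otimes>\<^bsub>E\<^esub> y = y \<otimes>\<^bsub>E\<^esub> z"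
    using E_onto_G by (elim exE conjE)
  interpret t: group_hom E G t
    by fact
  \<comment> \<open>The subgroup \<open>\<rho> ` ?D\<close> maps onto \<open>G\<close>, so arguments of commutators in \<open>E\<close> may be taken from it.\<close>
  have "derived E (carrier E) \<subseteq> derived E (\<rho> ` ?D)"
    unfolding derived_eq_rel_commutator[of E "carrier E"]
  proof (rule \<rho>.H.rel_commutator_least)
    have \<rho>D: "\<rho> ` ?D \<subseteq> carrier E"
      using DF by (auto intro: \<rho>.hom_closed)
    then show "subgroup (derived E (\<rho> ` ?D)) E"
      by (rule \<rho>.H.derived_is_subgroup)
    have lift: "\<exists>d\<in>\<rho> ` ?D. t a = t d" if a: "a \<in> carrier E" for a
    proof -
      have "t a \<in> \<pi> ` ?D"
        unfolding \<pi>D by (rule t.hom_closed[OF a])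
      then show ?thesis
        using t_\<rho> DF by (metis image_iff subsetD)
    qed
    fix a b assume a: "a \<in> carrier E" and b: "b \<in> carrier E"
    obtain c d where c: "c \<in> \<rho> ` ?D" "t a = t c" and d: "d \<in> \<rho> ` ?D" "t b = t d"
      using lift[OF a] lift[OF b] by blast
    have "a \<otimes>\<^bsub>E\<^esub> b \<otimes>\<^bsub>E\<^esub> inv\<^bsub>E\<^esub> a \<otimes>\<^bsub>E\<^esub> inv\<^bsub>E\<^esub> b = c \<otimes>\<^bsub>E\<^esub> d \<otimes>\<^bsub>E\<^esub> inv\<^bsub>E\<^esub> c \<otimes>\<^bsub>E\<^esub> inv\<^bsub>E\<^esub> d"
      by (rule t.commutator_cong_if_central_kernel) (use central a b c d \<rho>D in auto)
    also have "\<dots> \<in> derived E (\<rho> ` ?D)"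
      unfolding derived_eq_rel_commutator[of E] by (rule \<rho>.H.rel_commutator_incl[OF c(1) d(1)])
    finally show "a \<otimes>\<^bsub>E\<^esub> b \<otimes>\<^bsub>E\<^esub> inv\<^bsub>E\<^esub> a \<otimes>\<^bsub>E\<^esub> inv\<^bsub>E\<^esub> b \<in> derived E (\<rho> ` ?D)" .
  qed
  then have \<rho>D: "\<rho> ` ?D \<subseteq> \<rho> ` ?D2"
    unfolding \<rho>.derived_img[OF DF] unfolding \<rho>.derived_img[OF subset_refl, unfolded \<rho>_surj] .
  have D_sub: "subgroup ?D F" and D2_sub: "subgroup ?D2 F"
    by (rule \<pi>.G.derived_is_subgroup[OF subset_refl], rule \<pi>.G.derived_is_subgroup[OF DF])
  have D2_power: "f \<in> derived P K" if f: "f \<in> carrier P" and fD: "\<And>i. i \<in> {1..n} \<Longrightarrow> f i \<in> ?D2" for f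
  proof (rule \<pi>.G.mem_subgroup_if_embedded_coords[OF P.derived_is_subgroup[OF K.subset] f])
    fix i assume i: "i \<in> {1..n}"
    interpret e: group_hom F P "coord_embed F n i"
      using \<pi>.G.coord_embed_hom by unfold_locales
    have "coord_embed F n i ` ?D2 = derived P (coord_embed F n i ` ?D)"
      by (rule e.derived_img[OF DF, symmetric])
    also have "\<dots> \<subseteq> derived P K"
      by (rule P.mono_derived) (use \<pi>.G.coord_embed_derived_mem_K_subgroup[OF i] in blast)
    finally show "coord_embed F n i (f i) \<in> derived P K"
      using fD[OF i] by blast
  qed
  have "carrier Q \<subseteq> q ` derived P K"
  proof
    fix u assume "u \<in> carrier Q"
    then obtain f where f: "f \<in> K" "u = q f"
      unfolding carrier_Q by blast
    have fP: "f \<in> carrier P"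
      using f(1) by simp
    have "\<exists>d. d \<in> ?D2 \<and> \<pi> d = \<pi> (f i)" if i: "i \<in> {1..n}" for i
    proof -
      have "\<pi> (f i) \<in> \<pi> ` ?D2"
        unfolding \<pi>D2 by (rule \<pi>.hom_closed[OF \<pi>.G.coord_closed[OF fP i]])
      then show ?thesis
        by (metis imageE)
    qed
    then obtain d' where d': "\<And>i. i \<in> {1..n} \<Longrightarrow> d' i \<in> ?D2 \<and> \<pi> (d' i) = \<pi> (f i)"
      by metis
    define d where "d = restrict d' {1..n}"
    have d: "d i \<in> ?D2" "\<pi> (d i) = \<pi> (f i)" if "i \<in> {1..n}" for i
      using that d' by (simp_all add: d_def)
    have dP: "d \<in> carrier P"
      unfolding carrier_power_group d_def using d' D2F by auto
    have pd: "prd d \<in> ?D2"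
      by (rule subgroup.coord_prod_mem[OF D2_sub d(1)])
    have pf: "prd f \<in> ?D"
      using f(1) unfolding mem_K_iff by blast
    have cl: "prd d \<in> carrier F" "prd f \<in> carrier F"
      using fP dP by (simp_all add: \<pi>.G.coord_prod_closed)
    have "prd f \<otimes>\<^bsub>F\<^esub> inv\<^bsub>F\<^esub> prd d \<in> ?D"
      using pd pf D2D D_sub by (intro subgroup.m_closed[OF D_sub] subgroup.m_inv_closed[OF D_sub]) auto
    then obtain s where s: "s \<in> ?D2" "\<rho> s = \<rho> (prd f \<otimes>\<^bsub>F\<^esub> inv\<^bsub>F\<^esub> prd d)"
      using \<rho>D by (metis (no_types, lifting) imageE image_eqI subsetD)
    have sF: "s \<in> carrier F"
      using s(1) D2F by blast
    have "\<pi> s = \<pi> (prd f \<otimes>\<^bsub>F\<^esub> inv\<^bsub>F\<^esub> prd d)"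
      using bspec[OF t_\<rho> sF] bspec[OF t_\<rho>, of "prd f \<otimes>\<^bsub>F\<^esub> inv\<^bsub>F\<^esub> prd d"] s(2) cl by simp
    also have "\<dots> = \<one>\<^bsub>G\<^esub>"
      using \<pi>.hom_coord_prod_cong[OF dP fP d(2)] cl by simp
    finally have \<pi>s: "\<pi> s = \<one>\<^bsub>G\<^esub>" .
    let ?g = "coord_embed F n 1 s \<otimes>\<^bsub>P\<^esub> d"
    have gP: "?g \<in> carrier P"
      by (intro P.m_closed \<pi>.G.coord_embed_closed sF dP)
    have g: "?g i = (if i = 1 then s \<otimes>\<^bsub>F\<^esub> d i else d i)" if i: "i \<in> {1..n}" for i
      using i \<pi>.G.coord_closed[OF dP i] by (simp add: mult_power_group coord_embed_def)
    have "q f = q ?g"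
    proof (rule q_eq_if_same_invariants[OF fP gP])
      show "\<pi> (f i) = \<pi> (?g i)" if i: "i \<in> {1..n}" for i
      proof -
        have "\<pi> (s \<otimes>\<^bsub>F\<^esub> d i) = \<pi> (f i)"
          using d(2)[OF i] \<pi>.G.coord_closed[OF dP i] \<pi>.G.coord_closed[OF fP i] sF \<pi>s by simp
        then show ?thesis
          using d(2)[OF i] unfolding g[OF i] by (metis (full_types))
      qed
      have "prd ?g = s \<otimes>\<^bsub>F\<^esub> prd d"
        by (rule \<pi>.G.coord_prod_coord_embed_mult[OF _ sF dP]) (use n in simp)
      then show "\<rho> (prd f) = \<rho> (prd ?g)"
        using cl sF s(2) by (simp add: \<rho>.H.m_assoc)
    qed
    moreover have "?g \<in> derived P K"
    proof (rule D2_power[OF gP])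
      show "?g i \<in> ?D2" if i: "i \<in> {1..n}" for i
        unfolding g[OF i] using d(1)[OF i] subgroup.m_closed[OF D2_sub s(1) d(1)[OF i]]
        by (metis (full_types))
    qed
    ultimately show "u \<in> q ` derived P K"
      unfolding f(2) by (rule image_eqI)
  qed
  also have "q ` derived P K = derived Q (carrier Q)"
    using q.derived_img[OF subset_refl] P.derived_consistent[OF subset_refl K.subgroup_axioms]
    unfolding carrier_Q by simp
  finally have "carrier Q \<subseteq> derived Q (carrier Q)" .
  moreover have "derived Q (carrier Q) \<subseteq> carrier Q"
    by (rule q.H.derived_in_carrier[OF subset_refl])
  ultimately show ?thesis
    unfolding perfect_def by (rule subset_antisym[rotated])
qed

lemma K_tilde_properties:
  "(finite (carrier G) \<longleftrightarrow> finite (carrier Q))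
    \<and> (nilpotent G \<longleftrightarrow> nilpotent Q) \<and> (perfect G \<longleftrightarrow> perfect Q) \<and> (solvable G \<longleftrightarrow> solvable Q)"
proof -
  obtain s where s: "group_hom Q G s" "s ` carrier Q = carrier G"
    using Q_onto_G by blast
  interpret s: group_hom Q G s
    by fact
  have "finite (carrier Q) \<Longrightarrow> finite (carrier G)"
    unfolding s(2)[symmetric] by (rule finite_imageI)
  then show ?thesis
    using finite_Q nilpotent_Q perfect_Q solvable_Q s.surj_hom_imp_nilpotent[OF s(2)]
      s.surj_hom_imp_perfect[OF s(2)] s.surj_hom_imp_solvable[OF s(2)] by satx
qed

end

theorem proposition2p6:
  fixes G :: "('a, 'b) monoid_scheme"
    and F :: "('f, 'c) monoid_scheme"
    and N :: "'f set"
    and n :: nat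
  assumes "group G"
    and "n \<ge> 2"
    and "presentation F N G"
  shows "(finite (carrier G) \<longleftrightarrow> finite (carrier (K_tilde F N n)))
    \<and> (nilpotent G \<longleftrightarrow> nilpotent (K_tilde F N n))
    \<and> (perfect G \<longleftrightarrow> perfect (K_tilde F N n))
    \<and> (solvable G \<longleftrightarrow> solvable (K_tilde F N n))"
proof -
  have N: "N \<lhd> F" and iso: "F Mod N \<cong> G"
    using assms(3) unfolding presentation_def by blast+
  interpret N: normal N F
    by (rule N)
  interpret FN: group "F Mod N"
    by (rule N.factorgroup_is_group)
  interpret G: group G
    by (rule assms(1))
  obtain \<phi> where \<phi>: "\<phi> \<in> iso (F Mod N) G"
    using iso unfolding is_iso_def by blast
  define \<pi> where "\<pi> x = \<phi> (N #>\<^bsub>F\<^esub> x)" for x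
  have hom: "\<pi> \<in> hom F G"
    using hom_compose[OF N.r_coset_hom_Mod, of \<phi> G] \<phi> unfolding iso_def comp_def \<pi>_def by blast
  interpret \<pi>: group_hom F G \<pi>
    using hom by unfold_locales
  have surj: "\<pi> ` carrier F = carrier G"
    using \<phi> unfolding \<pi>_def iso_def bij_betw_def carrier_FactGroup by (simp add: image_image)
  have "kernel (F Mod N) G \<phi> = {\<one>\<^bsub>F Mod N\<^esub>}"
    using \<phi> iso_kernel_image[OF FN.group_axioms assms(1)] by blast
  then have "\<pi> x = \<one>\<^bsub>G\<^esub> \<longleftrightarrow> N #>\<^bsub>F\<^esub> x = \<one>\<^bsub>F Mod N\<^esub>" if "x \<in> carrier F" for x
    using that unfolding \<pi>_def kernel_def carrier_FactGroup by auto
  then have "kernel F G \<pi> = kernel F (F Mod N) (\<lambda>x. N #>\<^bsub>F\<^esub> x)"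
    unfolding kernel_def by (intro Collect_cong conj_cong refl)
  then have ker: "kernel F G \<pi> = N"
    unfolding N.kernel_r_coset .
  define R where "R = rel_commutator F N (carrier F)"
  interpret R: normal R F
    unfolding R_def by (intro N.rel_commutator_normal N N.normal_self)
  interpret central_presentation F G "F Mod R" \<pi> "\<lambda>x. R #>\<^bsub>F\<^esub> x" n
  proof (intro central_presentation.intro central_presentation_axioms.intro \<pi>.group_hom_axioms surj assms(2))
    show "group_hom F (F Mod R) (\<lambda>x. R #>\<^bsub>F\<^esub> x)"
      by (intro group_hom.intro group_hom_axioms.intro R.factorgroup_is_group R.r_coset_hom_Mod N.group_axioms)
    show "(\<lambda>x. R #>\<^bsub>F\<^esub> x) ` carrier F = carrier (F Mod R)"
      by (simp add: carrier_FactGroup)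
    show "kernel F (F Mod R) (\<lambda>x. R #>\<^bsub>F\<^esub> x) = rel_commutator F (kernel F G \<pi>) (carrier F)"
      using R.kernel_r_coset unfolding ker R_def .
  qed
  show ?thesis
    using K_tilde_properties unfolding ker .
qed

end
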